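(* Let $d\ge 1$ be an integer. For constrained delegation with degree-$d$ states there is a polynomial-time $\left(2-\frac{1}{d^2}\right)$-approximation algorithm.
   Context: Constrained delegation. An instance consists of a finite set $\Theta$ of states partitioned as $\Theta=\Theta_A\sqcup\Theta_R$ (acceptable and rejectable states), a finite set $\Sigma$ of signals, rational probabilities $q_\theta>0$ with $\sum_\theta q_\theta=1$, and a bipartite graph $H=(\Theta\cup\Sigma,E)$, $E\subseteq\Theta\times\Sigma$, without isolated vertices; $(\theta,\sigma)\in E$ means that $\sigma$ may be sent in state $\theta$, and $N(\theta)$ is the set of signals adjacent to $\theta$. The receiver commits to a decision scheme $\psi:\Sigma\to[0,1]$, where $\psi(\sigma)$ is the probability of accepting upon signal $\sigma$. In state $\theta$ the sender then sends a signal in $N(\theta)$ maximizing the acceptance probability. The receiver gets $1$ for accepting in a state of $\Theta_A$ or rejecting in a state of $\Theta_R$, and $0$ otherwise, so her utility is $$U_r(\psi)=\sum_{\theta\in\Theta_A}q_\theta\max_{\sigma\in N(\theta)}\psi(\sigma)+\sum_{\theta\in\Theta_R}q_\theta\Big(1-\max_{\sigma\in N(\theta)}\psi(\sigma)\Big).$$ The goal is to find $\psi$ maximizing $U_r(\psi)$; let $\mathrm{OPT}$ be the maximum. An instance has degree-$d$ states if $|N(\theta)|\le d$ for every $\theta\in\Theta$. A $\rho$-approximation algorithm outputs a decision scheme with utility at least $\mathrm{OPT}/\rho$ (in expectation over the algorithm's internal randomness, if it is randomized). *)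

theory Defs
  imports
    "HOL-Probability.Probability"
    "HOL-Computational_Algebra.Polynomial"
    "HOL-Library.Log_Nat"
begin

section \<open>Constrained delegation\<close>

record ('s, 'g) delegation =
  acceptable :: "'s set"
  rejectable :: "'s set"
  signals :: "'g set"
  state_prob :: "'s \<Rightarrow> rat"
  edges :: "('s \<times> 'g) set"

definition states :: "('s, 'g) delegation \<Rightarrow> 's set" where
  "states I = acceptable I \<union> rejectable I"

definition nbrs :: "('s, 'g) delegation \<Rightarrow> 's \<Rightarrow> 'g set" where
  "nbrs I \<theta> = {\<sigma>. (\<theta>, \<sigma>) \<in> edges I}"

definition delegation_instance :: "('s, 'g) delegation \<Rightarrow> bool" where
  "delegation_instance I \<longleftrightarrow>
     finite (states I) \<and> finite (signals I) \<and>
     acceptable I \<inter> rejectable I = {} \<and>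
     (\<forall>\<theta>\<in>states I. state_prob I \<theta> > 0) \<and>
     (\<Sum>\<theta>\<in>states I. state_prob I \<theta>) = 1 \<and>
     edges I \<subseteq> states I \<times> signals I \<and>
     (\<forall>\<theta>\<in>states I. \<exists>\<sigma>. (\<theta>, \<sigma>) \<in> edges I) \<and>
     (\<forall>\<sigma>\<in>signals I. \<exists>\<theta>. (\<theta>, \<sigma>) \<in> edges I)"

definition degree_states :: "nat \<Rightarrow> ('s, 'g) delegation \<Rightarrow> bool" where
  "degree_states d I \<longleftrightarrow> (\<forall>\<theta>\<in>states I. card (nbrs I \<theta>) \<le> d)"

text \<open>A scheme is a function on the whole signal type; its values outside
  \<^term>\<open>signals I\<close> are irrelevant.\<close>

definition decision_scheme :: "('s, 'g) delegation \<Rightarrow> ('g \<Rightarrow> real) \<Rightarrow> bool" where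
  "decision_scheme I \<psi> \<longleftrightarrow> (\<forall>\<sigma>\<in>signals I. 0 \<le> \<psi> \<sigma> \<and> \<psi> \<sigma> \<le> 1)"

definition receiver_utility :: "('s, 'g) delegation \<Rightarrow> ('g \<Rightarrow> real) \<Rightarrow> real" where
  "receiver_utility I \<psi> =
     (\<Sum>\<theta>\<in>acceptable I. of_rat (state_prob I \<theta>) * Max (\<psi> ` nbrs I \<theta>)) +
     (\<Sum>\<theta>\<in>rejectable I. of_rat (state_prob I \<theta>) * (1 - Max (\<psi> ` nbrs I \<theta>)))"

text \<open>The utility is continuous on the compact set of schemes, so for an instance this
  supremum is the maximum.\<close>

definition OPT :: "('s, 'g) delegation \<Rightarrow> real" where
  "OPT I = (SUP \<psi> \<in> {\<psi>. decision_scheme I \<psi>}. receiver_utility I \<psi>)"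


section \<open>Model of computation\<close>

text \<open>
  Randomized algorithms are while programs over finitely many arrays of natural numbers, under
  the logarithmic cost criterion: every operation is charged for the binary lengths of the
  addresses and numbers it handles. This is the random access machine with logarithmic cost
  (structured control flow, several memories), whose running times are polynomially
  related to those of Turing machines. A scalar variable is an array used at index 0 only.
  In tests, a number is true iff it is nonzero; subtraction is truncated and division by 0
  yields 0.
\<close>

type_synonym mem = "string \<Rightarrow> nat \<Rightarrow> nat"

datatype aexp =
    Const nat
  | Cell string aexp
  | Add aexp aexp
  | Sub aexp aexp
  | Mul aexp aexp
  | Div aexp aexp

datatype com =
    Skip
  | Assign string aexp aexp   \<comment> \<open>\<open>Assign x i e\<close> is \<open>x[i] := e\<close>\<close>
  | Flip string aexp          \<comment> \<open>\<open>x[i]\<close> := a fresh uniformly random bit\<close>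
  | Seq com com
  | Cond aexp com com
  | While aexp com

fun aval :: "aexp \<Rightarrow> mem \<Rightarrow> nat" where
  "aval (Const k) s = k"
| "aval (Cell x i) s = s x (aval i s)"
| "aval (Add a b) s = aval a s + aval b s"
| "aval (Sub a b) s = aval a s - aval b s"
| "aval (Mul a b) s = aval a s * aval b s"
| "aval (Div a b) s = aval a s div aval b s"

definition num_cost :: "nat \<Rightarrow> nat" where
  "num_cost k = 1 + floorlog 2 k"   \<comment> \<open>\<open>floorlog 2 k\<close> is the length of \<open>k\<close> in binary\<close>

fun acost :: "aexp \<Rightarrow> mem \<Rightarrow> nat" where
  "acost (Const k) s = num_cost k"
| "acost (Cell x i) s = acost i s + num_cost (aval i s) + num_cost (s x (aval i s))"
| "acost (Add a b) s = acost a s + acost b s + num_cost (aval a s) + num_cost (aval b s)"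
| "acost (Sub a b) s = acost a s + acost b s + num_cost (aval a s) + num_cost (aval b s)"
| "acost (Mul a b) s = acost a s + acost b s + num_cost (aval a s) + num_cost (aval b s)"
| "acost (Div a b) s = acost a s + acost b s + num_cost (aval a s) + num_cost (aval b s)"

definition store :: "mem \<Rightarrow> string \<Rightarrow> nat \<Rightarrow> nat \<Rightarrow> mem" where
  "store s x i v = s(x := (s x)(i := v))"

text \<open>\<open>exec c s \<omega> t s' \<omega>'\<close>: started in memory \<open>s\<close> with the sequence \<open>\<omega>\<close> of coin tosses,
  program \<open>c\<close> halts in memory \<open>s'\<close> with unused coin tosses \<open>\<omega>'\<close>, at total cost \<open>t\<close>.\<close>

inductive exec ::
  "com \<Rightarrow> mem \<Rightarrow> bool stream \<Rightarrow> nat \<Rightarrow> mem \<Rightarrow> bool stream \<Rightarrow> bool" where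
  Skip: "exec Skip s \<omega> 1 s \<omega>"
| Assign: "exec (Assign x i e) s \<omega>
    (acost i s + acost e s + num_cost (aval i s) + num_cost (aval e s))
    (store s x (aval i s) (aval e s)) \<omega>"
| Flip: "exec (Flip x i) s \<omega>
    (acost i s + num_cost (aval i s) + 1)
    (store s x (aval i s) (of_bool (shd \<omega>))) (stl \<omega>)"
| Seq: "exec c1 s \<omega> t1 s1 \<omega>1 \<Longrightarrow> exec c2 s1 \<omega>1 t2 s2 \<omega>2 \<Longrightarrow>
    exec (Seq c1 c2) s \<omega> (t1 + t2) s2 \<omega>2"
| CondTrue: "aval b s \<noteq> 0 \<Longrightarrow> exec c1 s \<omega> t s1 \<omega>1 \<Longrightarrow>
    exec (Cond b c1 c2) s \<omega> (acost b s + num_cost (aval b s) + t) s1 \<omega>1"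
| CondFalse: "aval b s = 0 \<Longrightarrow> exec c2 s \<omega> t s1 \<omega>1 \<Longrightarrow>
    exec (Cond b c1 c2) s \<omega> (acost b s + num_cost (aval b s) + t) s1 \<omega>1"
| WhileFalse: "aval b s = 0 \<Longrightarrow>
    exec (While b c) s \<omega> (acost b s + num_cost (aval b s)) s \<omega>"
| WhileTrue: "aval b s \<noteq> 0 \<Longrightarrow> exec c s \<omega> t1 s1 \<omega>1 \<Longrightarrow>
    exec (While b c) s1 \<omega>1 t2 s2 \<omega>2 \<Longrightarrow>
    exec (While b c) s \<omega> (acost b s + num_cost (aval b s) + t1 + t2) s2 \<omega>2"

inductive_cases SkipE: "exec Skip s \<omega> t s' \<omega>'"
inductive_cases AssignE: "exec (Assign x i e) s \<omega> t s' \<omega>'"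
inductive_cases FlipE: "exec (Flip x i) s \<omega> t s' \<omega>'"
inductive_cases SeqE: "exec (Seq c1 c2) s \<omega> t s' \<omega>'"
inductive_cases CondE: "exec (Cond b c1 c2) s \<omega> t s' \<omega>'"
inductive_cases WhileE: "exec (While b c) s \<omega> t s' \<omega>'"

lemma exec_deterministic:
  "exec c s \<omega> t s1 \<omega>1 \<Longrightarrow> exec c s \<omega> t' s2 \<omega>2 \<Longrightarrow> t = t' \<and> s1 = s2 \<and> \<omega>1 = \<omega>2"
proof (induction arbitrary: t' s2 \<omega>2 rule: exec.induct)
  case Skip
  from Skip.prems show ?case by (rule SkipE) simp
next
  case Assign
  from Assign.prems show ?case by (rule AssignE) simp
next
  case Flip
  from Flip.prems show ?case by (rule FlipE) simp
next
  case (Seq c1 s \<omega> t1 s1 \<omega>1 c2 t2 s3 \<omega>3)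
  from Seq.prems show ?case
  proof (rule SeqE)
    fix u1 r1 \<nu>1 u2
    assume *: "exec c1 s \<omega> u1 r1 \<nu>1" "exec c2 r1 \<nu>1 u2 s2 \<omega>2" "t' = u1 + u2"
    from Seq.IH(1)[OF *(1)] Seq.IH(2)[of u2 s2 \<omega>2] *(2,3) show ?thesis by simp
  qed
next
  case (CondTrue b s c1 \<omega> t s1 \<omega>1 c2)
  from CondTrue.prems show ?case
  proof (rule CondE)
    fix u
    assume *: "t' = acost b s + num_cost (aval b s) + u" "exec c1 s \<omega> u s2 \<omega>2"
    from CondTrue.IH[OF *(2)] *(1) CondTrue.hyps(1) show ?thesis by simp
  qed (use CondTrue.hyps(1) in simp)
next
  case (CondFalse b s c2 \<omega> t s1 \<omega>1 c1)
  from CondFalse.prems show ?case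
  proof (rule CondE)
    fix u
    assume *: "t' = acost b s + num_cost 0 + u" "exec c2 s \<omega> u s2 \<omega>2"
    from CondFalse.IH[OF *(2)] *(1) CondFalse.hyps(1) show ?thesis by simp
  qed (use CondFalse.hyps(1) in simp)
next
  case (WhileFalse b s c \<omega>)
  from WhileFalse.prems show ?case
    by (rule WhileE) (simp_all add: WhileFalse.hyps)
next
  case (WhileTrue b s c \<omega> t1 s1 \<omega>1 t2 s3 \<omega>3)
  from WhileTrue.prems show ?case
  proof (rule WhileE)
    fix u1 r1 \<nu>1 u2
    assume *: "exec c s \<omega> u1 r1 \<nu>1" "exec (While b c) r1 \<nu>1 u2 s2 \<omega>2"
      "t' = acost b s + num_cost (aval b s) + u1 + u2"
    from WhileTrue.IH(1)[OF *(1)] WhileTrue.IH(2)[of u2 s2 \<omega>2] *(2,3) show ?thesis by simp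
  qed (use WhileTrue.hyps(1) in simp)
qed

definition final_mem :: "com \<Rightarrow> mem \<Rightarrow> bool stream \<Rightarrow> mem" where
  "final_mem c s \<omega> = (THE s'. \<exists>t \<omega>'. exec c s \<omega> t s' \<omega>')"

definition input_mem :: "nat list \<Rightarrow> mem" where
  "input_mem xs = (\<lambda>x i. if x = ''in'' \<and> i < length xs then xs ! i else 0)"

definition input_size :: "nat list \<Rightarrow> nat" where
  "input_size xs = sum_list (map num_cost xs)"

definition coin_space :: "bool stream measure" where
  "coin_space = stream_space (measure_pmf (bernoulli_pmf (1/2)))"


section \<open>Approximation algorithms for constrained delegation\<close>

text \<open>Algorithms receive the states and signals numbered consecutively from 0.\<close>

definition numbered :: "(nat, nat) delegation \<Rightarrow> bool" where
  "numbered I \<longleftrightarrow> states I = {..<card (states I)} \<and> signals I = {..<card (signals I)}"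

text \<open>The input lists the numbers of states and signals and then, for each state, whether it is
  acceptable, numerator and denominator of its probability, and its adjacency row.\<close>

definition encode :: "(nat, nat) delegation \<Rightarrow> nat list" where
  "encode I = [card (states I), card (signals I)] @
     concat (map (\<lambda>\<theta>.
         [of_bool (\<theta> \<in> acceptable I),
          nat (fst (quotient_of (state_prob I \<theta>))),
          nat (snd (quotient_of (state_prob I \<theta>)))] @
         map (\<lambda>\<sigma>. of_bool ((\<theta>, \<sigma>) \<in> edges I)) [0..<card (signals I)])
       [0..<card (states I)])"

text \<open>The output is a scheme with rational values, given by numerators and denominators.\<close>

definition decode_scheme :: "mem \<Rightarrow> nat \<Rightarrow> real" where
  "decode_scheme s \<sigma> = real (s ''num'' \<sigma>) / real (s ''den'' \<sigma>)"

definition valid_output :: "(nat, nat) delegation \<Rightarrow> mem \<Rightarrow> bool" where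
  "valid_output I s \<longleftrightarrow>
     (\<forall>\<sigma>\<in>signals I. s ''den'' \<sigma> > 0) \<and> decision_scheme I (decode_scheme s)"

definition output_mem :: "com \<Rightarrow> (nat, nat) delegation \<Rightarrow> bool stream \<Rightarrow> mem" where
  "output_mem c I \<omega> = final_mem c (input_mem (encode I)) \<omega>"

definition poly_time_on :: "(nat, nat) delegation set \<Rightarrow> com \<Rightarrow> bool" where
  "poly_time_on X c \<longleftrightarrow>
     (\<exists>p :: nat poly. \<forall>I\<in>X. \<forall>\<omega>. \<exists>t s' \<omega>'.
        exec c (input_mem (encode I)) \<omega> t s' \<omega>' \<and> t \<le> poly p (input_size (encode I)))"

definition approximates_on :: "(nat, nat) delegation set \<Rightarrow> real \<Rightarrow> com \<Rightarrow> bool" where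
  "approximates_on X \<rho> c \<longleftrightarrow>
     (\<forall>I\<in>X.
        (\<forall>\<omega>. valid_output I (output_mem c I \<omega>)) \<and>
        (\<integral>\<omega>. receiver_utility I (decode_scheme (output_mem c I \<omega>)) \<partial>coin_space) \<ge> OPT I / \<rho>)"

definition degree_instances :: "nat \<Rightarrow> (nat, nat) delegation set" where
  "degree_instances d = {I. delegation_instance I \<and> numbered I \<and> degree_states d I}"

end

theory Submission
  imports Defs
begin

text \<open>
  Let \<open>w\<^sub>A \<sigma>\<close> and \<open>w\<^sub>R \<sigma>\<close> be the probabilities of an acceptable and of a rejectable state adjacent
  to \<open>\<sigma>\<close>, and let \<open>S\<close> consist of the signals with \<open>d * w\<^sub>R \<sigma> \<le> w\<^sub>A \<sigma>\<close>. Accepting exactly on \<open>S\<close>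
  yields at least as much as any scheme does when its maximum over a neighbourhood is replaced by
  the sum divided by \<open>d\<close> in acceptable states and by the sum in rejectable states. If an optimal
  scheme \<open>\<psi>\<close> earns \<open>a\<close> in acceptable and \<open>r\<close> in rejectable states, then the scheme \<open>\<psi> / d\<close>
  shows that \<open>S\<close> yields at least \<open>a / d\<^sup>2 + r\<close>. Always accepting yields at least \<open>a\<close>. The
  mixture that accepts outside \<open>S\<close> with probability \<open>(d\<^sup>2 - 1) / (2 * d\<^sup>2 - 1)\<close> balances
  the two bounds. It is deterministic and needs no linear programming: exact comparison of the
  weights over a common denominator suffices.
\<close>

section \<open>The greedy scheme\<close>

definition signal_weight :: "('s, 'g) delegation \<Rightarrow> 's set \<Rightarrow> 'g \<Rightarrow> real" where
  "signal_weight I X \<sigma> = (\<Sum>\<theta>\<in>X. of_rat (state_prob I \<theta>) * of_bool ((\<theta>, \<sigma>) \<in> edges I))"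

definition greedy_signals :: "nat \<Rightarrow> ('s, 'g) delegation \<Rightarrow> 'g set" where
  "greedy_signals d I = {\<sigma>. real d * signal_weight I (rejectable I) \<sigma> \<le> signal_weight I (acceptable I) \<sigma>}"

lemma
  assumes "delegation_instance I" "\<theta> \<in> states I"
  shows nbrs_subset: "nbrs I \<theta> \<subseteq> signals I"
    and nbrs_nonempty: "nbrs I \<theta> \<noteq> {}"
    and finite_nbrs: "finite (nbrs I \<theta>)"
    and state_prob_nonneg: "0 \<le> real_of_rat (state_prob I \<theta>)"
proof -
  show *: "nbrs I \<theta> \<subseteq> signals I"
    using assms by (auto simp: delegation_instance_def nbrs_def)
  show "nbrs I \<theta> \<noteq> {}"
    using assms by (auto simp: delegation_instance_def nbrs_def)
  show "finite (nbrs I \<theta>)"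
    using * assms by (auto simp: delegation_instance_def intro: finite_subset)
  show "0 \<le> real_of_rat (state_prob I \<theta>)"
    using assms by (auto simp: delegation_instance_def intro: less_imp_le)
qed

text \<open>Double counting of the edges: the sum over states and their neighbours becomes a sum
  over signals, in which the values of \<open>f\<close> at different signals no longer
  interact.\<close>

lemma sum_nbrs_eq_sum_signal_weight:
  assumes "delegation_instance I" "X \<subseteq> states I"
  shows "(\<Sum>\<theta>\<in>X. of_rat (state_prob I \<theta>) * sum f (nbrs I \<theta>)) =
         (\<Sum>\<sigma>\<in>signals I. f \<sigma> * signal_weight I X \<sigma>)"
proof -
  have "sum f (nbrs I \<theta>) = (\<Sum>\<sigma>\<in>signals I. f \<sigma> * of_bool ((\<theta>, \<sigma>) \<in> edges I))"
    if "\<theta> \<in> X" for \<theta>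
  proof -
    have "finite (signals I)" "nbrs I \<theta> \<subseteq> signals I"
      using assms that nbrs_subset[of I \<theta>] by (auto simp: delegation_instance_def)
    then show ?thesis
      by (intro sum.mono_neutral_cong_left) (auto simp: nbrs_def)
  qed
  then have "(\<Sum>\<theta>\<in>X. of_rat (state_prob I \<theta>) * sum f (nbrs I \<theta>)) =
      (\<Sum>\<theta>\<in>X. \<Sum>\<sigma>\<in>signals I. of_rat (state_prob I \<theta>) * (f \<sigma> * of_bool ((\<theta>, \<sigma>) \<in> edges I)))"
    by (intro sum.cong) (simp_all add: sum_distrib_left)
  also have "\<dots> = (\<Sum>\<sigma>\<in>signals I. f \<sigma> * signal_weight I X \<sigma>)"
    unfolding signal_weight_def sum_distrib_left
    by (subst sum.swap) (simp add: algebra_simps)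
  finally show ?thesis .
qed

lemma acceptable_states: "acceptable I \<subseteq> states I"
  and rejectable_states: "rejectable I \<subseteq> states I"
  by (auto simp: states_def)

text \<open>Replacing the maximum over a neighbourhood by the sum, divided by \<open>d\<close> in acceptable states,
  makes the utility linear in the scheme, and \<^term>\<open>greedy_signals d I\<close> maximizes the linear
  function.\<close>

lemma greedy_signals_utility:
  fixes \<psi> :: "'g \<Rightarrow> real"
  assumes I: "delegation_instance I" and deg: "degree_states d I" and "d \<ge> 1"
    and \<psi>: "decision_scheme I \<psi>"
  shows "(\<Sum>\<theta>\<in>acceptable I. of_rat (state_prob I \<theta>) * (sum \<psi> (nbrs I \<theta>) / d)) +
         (\<Sum>\<theta>\<in>rejectable I. of_rat (state_prob I \<theta>) * (1 - sum \<psi> (nbrs I \<theta>)))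
         \<le> receiver_utility I (indicator (greedy_signals d I))"
proof -
  define lin where "lin f =
    (\<Sum>\<theta>\<in>acceptable I. of_rat (state_prob I \<theta>) * (sum f (nbrs I \<theta>) / d)) +
    (\<Sum>\<theta>\<in>rejectable I. of_rat (state_prob I \<theta>) * (1 - sum f (nbrs I \<theta>)))" for f :: "'g \<Rightarrow> real"
  define g :: "'g \<Rightarrow> real" where "g = indicator (greedy_signals d I)"
  \<comment> \<open>The signals decouple, and the sign of its coefficient decides for each signal
    between 0 and 1; \<open>greedy_signals\<close> selects the nonnegative coefficients.\<close>
  have lin: "lin f = (\<Sum>\<theta>\<in>rejectable I. of_rat (state_prob I \<theta>)) +
      (\<Sum>\<sigma>\<in>signals I. f \<sigma> *
        (signal_weight I (acceptable I) \<sigma> / d - signal_weight I (rejectable I) \<sigma>))" for f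
  proof -
    have "lin f = (\<Sum>\<theta>\<in>acceptable I. of_rat (state_prob I \<theta>) * sum f (nbrs I \<theta>)) / d +
        ((\<Sum>\<theta>\<in>rejectable I. of_rat (state_prob I \<theta>)) -
         (\<Sum>\<theta>\<in>rejectable I. of_rat (state_prob I \<theta>) * sum f (nbrs I \<theta>)))"
      by (simp add: lin_def right_diff_distrib sum_subtractf sum_divide_distrib[symmetric])
    then show ?thesis
      by (simp add: sum_nbrs_eq_sum_signal_weight[OF I acceptable_states]
          sum_nbrs_eq_sum_signal_weight[OF I rejectable_states]
          right_diff_distrib sum_subtractf sum_divide_distrib)
  qed
  have "lin \<psi> \<le> lin g"
    unfolding lin
  proof (intro add_left_mono sum_mono)
    fix \<sigma> assume "\<sigma> \<in> signals I"
    then have "0 \<le> \<psi> \<sigma>" "\<psi> \<sigma> \<le> 1"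
      using \<psi> by (auto simp: decision_scheme_def)
    moreover have "\<sigma> \<in> greedy_signals d I \<longleftrightarrow>
        0 \<le> signal_weight I (acceptable I) \<sigma> / d - signal_weight I (rejectable I) \<sigma>"
      using \<open>d \<ge> 1\<close> by (simp add: greedy_signals_def field_simps)
    ultimately show "\<psi> \<sigma> * (signal_weight I (acceptable I) \<sigma> / d - signal_weight I (rejectable I) \<sigma>)
      \<le> g \<sigma> * (signal_weight I (acceptable I) \<sigma> / d - signal_weight I (rejectable I) \<sigma>)"
      by (cases "\<sigma> \<in> greedy_signals d I")
        (auto simp: g_def intro!: mult_left_le_one_le mult_nonneg_nonpos)
  qed
  \<comment> \<open>The linear function stays below the utility: a sum over at most \<open>d\<close>
    neighbours is at most \<open>d\<close> times the maximum, and for nonnegative values the maximum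
    is at most the sum.\<close>
  also have "lin g \<le> receiver_utility I g"
    unfolding lin_def receiver_utility_def
  proof (intro add_mono sum_mono mult_left_mono)
    fix \<theta> assume "\<theta> \<in> acceptable I"
    then have \<theta>: "\<theta> \<in> states I" by (simp add: states_def)
    note nb = nbrs_nonempty[OF I \<theta>] finite_nbrs[OF I \<theta>]
    have "Max (g ` nbrs I \<theta>) \<ge> 0"
      using nb by (auto simp: Max_ge_iff g_def)
    have "sum g (nbrs I \<theta>) \<le> card (nbrs I \<theta>) * Max (g ` nbrs I \<theta>)"
      using nb by (intro sum_bounded_above) auto
    also have "\<dots> \<le> d * Max (g ` nbrs I \<theta>)"
      using deg \<theta> \<open>Max (g ` nbrs I \<theta>) \<ge> 0\<close>
      by (intro mult_right_mono) (auto simp: degree_states_def)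
    finally show "sum g (nbrs I \<theta>) / d \<le> Max (g ` nbrs I \<theta>)"
      using \<open>d \<ge> 1\<close> by (simp add: field_simps)
    show "0 \<le> real_of_rat (state_prob I \<theta>)"
      using I \<theta> by (rule state_prob_nonneg)
  next
    fix \<theta> assume "\<theta> \<in> rejectable I"
    then have \<theta>: "\<theta> \<in> states I" by (simp add: states_def)
    note nb = nbrs_nonempty[OF I \<theta>] finite_nbrs[OF I \<theta>]
    have "Max (g ` nbrs I \<theta>) \<le> sum g (nbrs I \<theta>)"
      using nb by (auto simp: g_def intro!: member_le_sum)
    then show "1 - sum g (nbrs I \<theta>) \<le> 1 - Max (g ` nbrs I \<theta>)" by simp
    show "0 \<le> real_of_rat (state_prob I \<theta>)"
      using I \<theta> by (rule state_prob_nonneg)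
  qed
  finally show ?thesis by (simp add: lin_def g_def)
qed

text \<open>A monotone affine map commutes with the maximum over a nonempty finite set. Hence the
  utility is affine on the segment from \<open>\<psi>\<close> to constant acceptance, which earns
  the mass of the acceptable states.\<close>

lemma receiver_utility_mix_accept_all:
  assumes "delegation_instance I" "0 \<le> l" "l \<le> 1"
  shows "receiver_utility I (\<lambda>\<sigma>. l + (1 - l) * \<psi> \<sigma>) =
         l * (\<Sum>\<theta>\<in>acceptable I. of_rat (state_prob I \<theta>)) + (1 - l) * receiver_utility I \<psi>"
proof -
  have "Max ((\<lambda>\<sigma>. l + (1 - l) * \<psi> \<sigma>) ` nbrs I \<theta>) = l + (1 - l) * Max (\<psi> ` nbrs I \<theta>)"
    if "\<theta> \<in> states I" for \<theta>
  proof -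
    have "mono (\<lambda>x. l + (1 - l) * x)"
      using assms by (intro monoI add_left_mono mult_left_mono) auto
    from mono_Max_commute[OF this, of "\<psi> ` nbrs I \<theta>"] show ?thesis
      using nbrs_nonempty[OF assms(1) that] finite_nbrs[OF assms(1) that] by (simp add: image_image)
  qed
  then have "receiver_utility I (\<lambda>\<sigma>. l + (1 - l) * \<psi> \<sigma>) =
      (\<Sum>\<theta>\<in>acceptable I. of_rat (state_prob I \<theta>) * (l + (1 - l) * Max (\<psi> ` nbrs I \<theta>))) +
      (\<Sum>\<theta>\<in>rejectable I. of_rat (state_prob I \<theta>) * (1 - (l + (1 - l) * Max (\<psi> ` nbrs I \<theta>))))"
    unfolding receiver_utility_def
    by (intro arg_cong2[where f = "(+)"] sum.cong) (simp_all add: states_def)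
  also have "\<dots> = l * (\<Sum>\<theta>\<in>acceptable I. of_rat (state_prob I \<theta>)) + (1 - l) * receiver_utility I \<psi>"
    unfolding receiver_utility_def distrib_left sum_distrib_left add.assoc[symmetric] sum.distrib[symmetric]
    by (intro arg_cong2[where f = "(+)"] sum.cong) (simp_all add: algebra_simps)
  finally show ?thesis .
qed

section \<open>The mixture and its approximation ratio\<close>

text \<open>The solution \<open>l\<close> of \<open>l + (1 - l) / d^2 = 1 - l\<close>: the lower
  bound for the mixture then weights the earnings in acceptable and in rejectable states
  equally.\<close>

definition accept_fraction :: "nat \<Rightarrow> real" where
  "accept_fraction d = (real d ^ 2 - 1) / (2 * real d ^ 2 - 1)"

definition greedy_scheme :: "nat \<Rightarrow> ('s, 'g) delegation \<Rightarrow> 'g \<Rightarrow> real" where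
  "greedy_scheme d I \<sigma> = (if \<sigma> \<in> greedy_signals d I then 1 else accept_fraction d)"

text \<open>The last equation is what makes the weight of the greedy part the reciprocal of the
  approximation ratio.\<close>

lemma accept_fraction_bounds:
  assumes "d \<ge> 1"
  shows "0 \<le> accept_fraction d" "accept_fraction d \<le> 1"
    "1 - accept_fraction d = 1 / (2 - 1 / (real d)\<^sup>2)"
proof -
  have "real d ^ 2 \<ge> 1" using assms by simp
  then show "0 \<le> accept_fraction d" "accept_fraction d \<le> 1"
    by (auto simp: accept_fraction_def field_simps)
  have "1 / (2 - 1 / x) = x / (2 * x - 1)" if "x \<ge> 1" for x :: real
    using that by (simp add: divide_simps)
  from this[OF \<open>real d ^ 2 \<ge> 1\<close>] \<open>real d ^ 2 \<ge> 1\<close>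
  show "1 - accept_fraction d = 1 / (2 - 1 / (real d)\<^sup>2)"
    by (simp add: accept_fraction_def diff_divide_eq_iff)
qed

theorem greedy_scheme_approximation:
  assumes I: "delegation_instance I" and deg: "degree_states d I" and "d \<ge> 1"
  shows "OPT I / (2 - 1 / (real d)\<^sup>2) \<le> receiver_utility I (greedy_scheme d I)"
proof -
  define l where "l = accept_fraction d"
  note l = accept_fraction_bounds[OF \<open>d \<ge> 1\<close>, folded l_def]
  define U where "U = receiver_utility I (indicator (greedy_signals d I))"
  define A where "A = (\<Sum>\<theta>\<in>acceptable I. real_of_rat (state_prob I \<theta>))"
  have "greedy_scheme d I = (\<lambda>\<sigma>. l + (1 - l) * indicator (greedy_signals d I) \<sigma>)"
    by (auto simp: greedy_scheme_def l_def)
  then have greedy: "receiver_utility I (greedy_scheme d I) = l * A + (1 - l) * U"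
    using receiver_utility_mix_accept_all[OF I l(1,2)] by (simp add: A_def U_def)
  have d2: "real d ^ 2 \<ge> 1" using \<open>d \<ge> 1\<close> by simp
  have l1: "l = (1 - l) * (1 - 1 / real d ^ 2)"
  proof -
    have "(x - 1) / (2 * x - 1) = x / (2 * x - 1) * (1 - 1 / x)" if "x \<ge> 1" for x :: real
      using that by (simp add: divide_simps)
    from this[OF d2] show ?thesis
      using d2 by (simp add: l_def accept_fraction_def diff_divide_eq_iff)
  qed
  have "1 - l > 0"
  proof -
    have "(x - 1) / (2 * x - 1) < 1" if "x \<ge> 1" for x :: real
      using that by (simp add: divide_simps)
    from this[OF d2] show ?thesis
      by (simp add: l_def accept_fraction_def)
  qed
  have "receiver_utility I \<psi> \<le> receiver_utility I (greedy_scheme d I) / (1 - l)"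
    if \<psi>: "decision_scheme I \<psi>" for \<psi>
  proof -
    define a where "a = (\<Sum>\<theta>\<in>acceptable I. of_rat (state_prob I \<theta>) * Max (\<psi> ` nbrs I \<theta>))"
    define r where "r = (\<Sum>\<theta>\<in>rejectable I. of_rat (state_prob I \<theta>) * (1 - Max (\<psi> ` nbrs I \<theta>)))"
    have \<psi>_nbrs: "0 \<le> \<psi> \<sigma>" "\<psi> \<sigma> \<le> 1" if "\<theta> \<in> states I" "\<sigma> \<in> nbrs I \<theta>" for \<theta> \<sigma>
      using \<psi> that nbrs_subset[OF I that(1)] by (auto simp: decision_scheme_def)
    have a: "a / d ^ 2 = (\<Sum>\<theta>\<in>acceptable I.
        of_rat (state_prob I \<theta>) * (Max (\<psi> ` nbrs I \<theta>) / real d ^ 2))"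
      by (simp add: a_def sum_divide_distrib)
    \<comment> \<open>Passing to \<open>\<psi> / d\<close> brings the neighbourhood sums in
      rejectable states down to at most the maximum of \<open>\<psi>\<close>; in acceptable states
      it costs a second factor \<open>d\<close>.\<close>
    have "a / d ^ 2 + r \<le>
        (\<Sum>\<theta>\<in>acceptable I. of_rat (state_prob I \<theta>) * ((\<Sum>\<sigma>\<in>nbrs I \<theta>. \<psi> \<sigma> / d) / d)) +
        (\<Sum>\<theta>\<in>rejectable I. of_rat (state_prob I \<theta>) * (1 - (\<Sum>\<sigma>\<in>nbrs I \<theta>. \<psi> \<sigma> / d)))"
      unfolding a r_def
    proof (intro add_mono sum_mono mult_left_mono)
      fix \<theta> assume "\<theta> \<in> acceptable I"
      then have \<theta>: "\<theta> \<in> states I" by (simp add: states_def)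
      note nb = nbrs_nonempty[OF I \<theta>] finite_nbrs[OF I \<theta>]
      have "Max (\<psi> ` nbrs I \<theta>) \<le> sum \<psi> (nbrs I \<theta>)"
        using nb \<psi>_nbrs[OF \<theta>] by (auto intro!: member_le_sum)
      then show "Max (\<psi> ` nbrs I \<theta>) / (real d)\<^sup>2 \<le> (\<Sum>\<sigma>\<in>nbrs I \<theta>. \<psi> \<sigma> / d) / d"
        using d2 by (simp add: sum_divide_distrib[symmetric] power2_eq_square divide_right_mono)
      show "0 \<le> real_of_rat (state_prob I \<theta>)"
        using I \<theta> by (rule state_prob_nonneg)
    next
      fix \<theta> assume "\<theta> \<in> rejectable I"
      then have \<theta>: "\<theta> \<in> states I" by (simp add: states_def)
      note nb = nbrs_nonempty[OF I \<theta>] finite_nbrs[OF I \<theta>]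
      have "Max (\<psi> ` nbrs I \<theta>) \<ge> 0"
        using nb \<psi>_nbrs[OF \<theta>] by (auto simp: Max_ge_iff)
      have "sum \<psi> (nbrs I \<theta>) \<le> card (nbrs I \<theta>) * Max (\<psi> ` nbrs I \<theta>)"
        using nb by (intro sum_bounded_above) auto
      also have "\<dots> \<le> d * Max (\<psi> ` nbrs I \<theta>)"
        using deg \<theta> \<open>Max (\<psi> ` nbrs I \<theta>) \<ge> 0\<close>
        by (intro mult_right_mono) (auto simp: degree_states_def)
      finally show "1 - Max (\<psi> ` nbrs I \<theta>) \<le> 1 - (\<Sum>\<sigma>\<in>nbrs I \<theta>. \<psi> \<sigma> / d)"
        using \<open>d \<ge> 1\<close> by (simp add: sum_divide_distrib[symmetric] field_simps)
      show "0 \<le> real_of_rat (state_prob I \<theta>)"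
        using I \<theta> by (rule state_prob_nonneg)
    qed
    also have "\<dots> \<le> U"
      unfolding U_def
    proof (intro greedy_signals_utility I deg \<open>d \<ge> 1\<close>)
      have "x / d \<le> 1" if "0 \<le> x" "x \<le> 1" for x :: real
        using that \<open>d \<ge> 1\<close> by (simp add: field_simps)
      then show "decision_scheme I (\<lambda>\<sigma>. \<psi> \<sigma> / d)"
        using \<psi> by (auto simp: decision_scheme_def)
    qed
    finally have U: "a / d ^ 2 + r \<le> U" .
    have "a \<le> A"
      unfolding a_def A_def
    proof (intro sum_mono mult_left_le)
      fix \<theta> assume "\<theta> \<in> acceptable I"
      then have \<theta>: "\<theta> \<in> states I" by (simp add: states_def)
      show "Max (\<psi> ` nbrs I \<theta>) \<le> 1"
        using nbrs_nonempty[OF I \<theta>] finite_nbrs[OF I \<theta>] \<psi>_nbrs[OF \<theta>] by auto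
      show "0 \<le> real_of_rat (state_prob I \<theta>)"
        using I \<theta> by (rule state_prob_nonneg)
    qed
    \<comment> \<open>The term \<open>a / d^2\<close> falls short of \<open>a\<close> by the
      fraction \<open>1 - 1 / d^2\<close>, which always accepting supplies.\<close>
    then have "(1 - 1 / real d ^ 2) * a \<le> (1 - 1 / real d ^ 2) * A"
      using d2 \<open>d \<ge> 1\<close> by (intro mult_left_mono) (auto simp: divide_le_eq)
    with U have "a + r \<le> (1 - 1 / real d ^ 2) * A + U"
      by (simp add: algebra_simps)
    also have "\<dots> = (l * A + (1 - l) * U) / (1 - l)"
      using \<open>1 - l > 0\<close> by (subst l1) (simp add: add_divide_distrib)
    finally show ?thesis
      unfolding greedy by (simp add: receiver_utility_def a_def r_def)
  qed
  \<comment> \<open>The bound is uniform in the scheme and so passes to the supremum; the zero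
    scheme shows that the set of schemes is nonempty.\<close>
  then have "OPT I \<le> receiver_utility I (greedy_scheme d I) / (1 - l)"
    unfolding OPT_def by (intro cSUP_least) (auto simp: decision_scheme_def intro: exI[of _ "\<lambda>_. 0"])
  then have "(1 - l) * OPT I \<le> receiver_utility I (greedy_scheme d I)"
    using \<open>1 - l > 0\<close> by (simp add: pos_le_divide_eq mult.commute)
  then show ?thesis unfolding l(3) by simp
qed

section \<open>Total correctness with running times\<close>

text \<open>A constant counts with its value, so that memory bounds alone bound the value of an
  expression.\<close>

fun asize :: "aexp \<Rightarrow> nat" where
  "asize (Const k) = Suc k"
| "asize (Cell x i) = Suc (asize i)"
| "asize (Add a b) = asize a + asize b"
| "asize (Sub a b) = asize a + asize b"
| "asize (Mul a b) = asize a + asize b"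
| "asize (Div a b) = asize a + asize b"

text \<open>Positivity of \<open>B\<close> makes \<open>2 ^ B\<close> at least 2 and lets multiples
  of \<open>B\<close> absorb additive constants.\<close>

definition fits :: "nat \<Rightarrow> mem \<Rightarrow> bool" where
  "fits B s \<longleftrightarrow> B > 0 \<and> (\<forall>x i. s x i < 2 ^ B)"

text \<open>Bounds the running time in terms of a number of bits that suffices for every memory
  cell and that also bounds the number of iterations of each loop.\<close>

fun time_poly :: "com \<Rightarrow> nat poly" where
  "time_poly Skip = 1"
| "time_poly (Assign x i e) = [:0, 4 * (asize i)\<^sup>2 + 4 * (asize e)\<^sup>2:]"
| "time_poly (Flip x i) = [:1, 4 * (asize i)\<^sup>2:]"
| "time_poly (Seq c1 c2) = time_poly c1 + time_poly c2"
| "time_poly (Cond b c1 c2) = [:0, 4 * (asize b)\<^sup>2:] + time_poly c1 + time_poly c2"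
| "time_poly (While b c) = [:1, 1:] * ([:0, 4 * (asize b)\<^sup>2:] + time_poly c)"

lemma asize_pos: "asize e > 0"
  by (induction e) auto

text \<open>Bit lengths add up under multiplication. The same bound covers addition because
  \<open>x + y < X * Y\<close> whenever \<open>x < X\<close>, \<open>y < Y\<close> and both
  \<open>X\<close> and \<open>Y\<close> are at least 2.\<close>

lemma aval_less_asize:
  assumes "fits B s"
  shows "aval e s < 2 ^ (asize e * B)"
proof (induction e)
  case (Const k)
  have "k < 2 ^ Suc k" by (rule less_trans[OF less_exp]) simp
  also have "Suc k * 1 \<le> Suc k * B"
    using assms by (intro mult_le_mono2) (simp add: fits_def Suc_le_eq)
  then have "(2::nat) ^ Suc k \<le> 2 ^ (Suc k * B)"
    by (intro power_increasing) auto
  finally show ?case by simp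
next
  case (Cell x i)
  have "s x (aval i s) < 2 ^ B" using assms by (simp add: fits_def)
  also have "(2::nat) ^ B \<le> 2 ^ (asize (Cell x i) * B)"
    by (intro power_increasing) auto
  finally show ?case by simp
next
  case (Add a b)
  have "2 ^ 1 \<le> (2::nat) ^ (asize a * B)" "2 ^ 1 \<le> (2::nat) ^ (asize b * B)"
    using assms asize_pos[of a] asize_pos[of b]
    by (intro power_increasing; simp add: fits_def Suc_le_eq)+
  moreover have "x + y < X * Y" if "x < X" "y < Y" "2 ^ 1 \<le> X" "2 ^ 1 \<le> Y" for x y X Y :: nat
  proof -
    have "2 * Y \<le> X * Y" "X * 2 \<le> X * Y" using that by simp_all
    with that show ?thesis by linarith
  qed
  ultimately show ?case
    using Add by (simp add: distrib_right power_add)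
next
  case (Sub a b)
  have "aval a s - aval b s \<le> aval a s" by simp
  also have "\<dots> < 2 ^ (asize a * B)" by (rule Sub)
  also have "\<dots> \<le> 2 ^ (asize (Sub a b) * B)" by (intro power_increasing) auto
  finally show ?case by simp
next
  case (Mul a b)
  then show ?case
    by (simp add: distrib_right power_add mult_strict_mono')
next
  case (Div a b)
  have "aval a s div aval b s \<le> aval a s" by simp
  also have "\<dots> < 2 ^ (asize a * B)" by (rule Div)
  also have "\<dots> \<le> 2 ^ (asize (Div a b) * B)" by (intro power_increasing) auto
  finally show ?case by simp
qed

section \<open>Costs of expressions\<close>

lemma num_cost_le:
  assumes "k < 2 ^ w"
  shows "num_cost k \<le> Suc w"
  using assms floorlog_leI[of k 2 w] by (simp add: num_cost_def)

lemma num_cost_aval_le: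
  assumes "fits B s"
  shows "num_cost (aval e s) \<le> 2 * asize e * B"
proof -
  have "num_cost (aval e s) \<le> Suc (asize e * B)"
    by (intro num_cost_le aval_less_asize assms)
  also have "\<dots> \<le> 2 * asize e * B"
    using assms asize_pos[of e] by (auto simp: fits_def Suc_le_eq)
  finally show ?thesis .
qed

text \<open>Every node handles numbers of length linear in the sizes of its subexpressions, which
  sums up to a quadratic bound.\<close>

lemma acost_le:
  assumes "fits B s"
  shows "acost e s \<le> 2 * (asize e)\<^sup>2 * B"
proof (induction e)
  case (Const k)
  have "num_cost k \<le> 2 * Suc k * B"
    using num_cost_aval_le[OF assms, of "Const k"] by simp
  also have "\<dots> \<le> 2 * (Suc k)\<^sup>2 * B"
    by (intro mult_le_mono) (auto simp: power2_eq_square)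
  finally show ?case by simp
next
  case (Cell x i)
  have "num_cost (s x (aval i s)) \<le> Suc B"
    using assms by (intro num_cost_le) (simp add: fits_def)
  also have "\<dots> \<le> 2 * B" using assms by (simp add: fits_def)
  finally have "acost (Cell x i) s \<le> 2 * (asize i)\<^sup>2 * B + 2 * asize i * B + 2 * B"
    using Cell num_cost_aval_le[OF assms, of i] by simp
  also have "\<dots> \<le> 2 * (asize (Cell x i))\<^sup>2 * B"
    by (simp add: power2_eq_square algebra_simps)
  finally show ?case .
next
  \<comment> \<open>The cross term of the square pays for the lengths of the two operands.\<close>
  have *: "2 * a\<^sup>2 * B + 2 * b\<^sup>2 * B + 2 * a * B + 2 * b * B \<le> 2 * (a + b)\<^sup>2 * B"
    if "a > 0" "b > 0" for a b :: nat
  proof -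
    have "a * B \<le> a * b * B" "b * B \<le> a * b * B" using that by auto
    moreover have "2 * (a + b)\<^sup>2 * B = 2 * a\<^sup>2 * B + 2 * b\<^sup>2 * B + 4 * (a * b * B)"
      by (simp add: power2_eq_square algebra_simps)
    ultimately show ?thesis by linarith
  qed
  {
    case (Add a b)
    then show ?case
      using *[OF asize_pos asize_pos, of a b] num_cost_aval_le[OF assms, of a]
        num_cost_aval_le[OF assms, of b] by simp
  next
    case (Sub a b)
    then show ?case
      using *[OF asize_pos asize_pos, of a b] num_cost_aval_le[OF assms, of a]
        num_cost_aval_le[OF assms, of b] by simp
  next
    case (Mul a b)
    then show ?case
      using *[OF asize_pos asize_pos, of a b] num_cost_aval_le[OF assms, of a]
        num_cost_aval_le[OF assms, of b] by simp
  next
    case (Div a b)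
    then show ?case
      using *[OF asize_pos asize_pos, of a b] num_cost_aval_le[OF assms, of a]
        num_cost_aval_le[OF assms, of b] by simp
  }
qed

text \<open>In this form the bound is the value at \<open>B\<close> of the polynomial by which
  \<open>time_poly\<close> charges one evaluation.\<close>

lemma acost_plus_num_cost_le:
  assumes "fits B s"
  shows "acost e s + num_cost (aval e s) \<le> B * (4 * (asize e)\<^sup>2)"
proof -
  have "asize e * B \<le> (asize e)\<^sup>2 * B"
    by (intro mult_le_mono) (auto simp: power2_eq_square)
  then show ?thesis
    using acost_le[OF assms, of e] num_cost_aval_le[OF assms, of e]
    unfolding mult.commute[of B] mult.assoc by linarith
qed

section \<open>Hoare triples with time bounds\<close>

text \<open>Total correctness within a time fixed by the program text and \<open>B\<close>.
  Preserving \<open>fits B\<close> keeps the cost bounds applicable to the next command, and having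
  the same \<open>\<omega>\<close> before and after expresses that no coin is tossed.\<close>

definition triple :: "nat \<Rightarrow> (mem \<Rightarrow> bool) \<Rightarrow> com \<Rightarrow> (mem \<Rightarrow> bool) \<Rightarrow> bool" where
  "triple B P c Q \<longleftrightarrow> (\<forall>s \<omega>. fits B s \<longrightarrow> P s \<longrightarrow>
     (\<exists>t s'. exec c s \<omega> t s' \<omega> \<and> t \<le> poly (time_poly c) B \<and> fits B s' \<and> Q s'))"

lemma tripleI:
  assumes "\<And>s \<omega>. fits B s \<Longrightarrow> P s \<Longrightarrow>
    \<exists>t s'. exec c s \<omega> t s' \<omega> \<and> t \<le> poly (time_poly c) B \<and> fits B s' \<and> Q s'"
  shows "triple B P c Q"
  using assms by (simp add: triple_def)

lemma tripleE:
  assumes "triple B P c Q" "fits B s" "P s"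
  obtains t s' where "exec c s \<omega> t s' \<omega>" "t \<le> poly (time_poly c) B" "fits B s'" "Q s'"
  using assms unfolding triple_def by blast

text \<open>Assignments are the source of new memory contents, so it is here that the value written
  must be shown to have at most \<open>B\<close> bits.\<close>

lemma triple_Assign:
  assumes "\<And>s. fits B s \<Longrightarrow> P s \<Longrightarrow> aval e s < 2 ^ B \<and> Q (store s x (aval i s) (aval e s))"
  shows "triple B P (Assign x i e) Q"
proof (rule tripleI)
  fix s and \<omega> :: "bool stream"
  assume s: "fits B s" "P s"
  have "acost i s + acost e s + num_cost (aval i s) + num_cost (aval e s)
      \<le> poly (time_poly (Assign x i e)) B"
    using acost_plus_num_cost_le[OF s(1), of i] acost_plus_num_cost_le[OF s(1), of e]
    by (simp add: distrib_left)
  moreover have "fits B (store s x (aval i s) (aval e s))"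
    using s assms[OF s] by (auto simp: fits_def store_def)
  ultimately show "\<exists>t s'. exec (Assign x i e) s \<omega> t s' \<omega> \<and>
      t \<le> poly (time_poly (Assign x i e)) B \<and> fits B s' \<and> Q s'"
    using assms[OF s] exec.Assign by blast
qed

lemma triple_Seq:
  assumes "triple B P c1 Q" "triple B Q c2 R"
  shows "triple B P (Seq c1 c2) R"
proof (rule tripleI)
  fix s and \<omega> :: "bool stream"
  assume s: "fits B s" "P s"
  obtain t1 s1 where 1: "exec c1 s \<omega> t1 s1 \<omega>" "t1 \<le> poly (time_poly c1) B" "fits B s1" "Q s1"
    by (rule tripleE[OF assms(1) s])
  obtain t2 s2 where 2: "exec c2 s1 \<omega> t2 s2 \<omega>" "t2 \<le> poly (time_poly c2) B" "fits B s2" "R s2"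
    by (rule tripleE[OF assms(2) 1(3,4)])
  show "\<exists>t s'. exec (Seq c1 c2) s \<omega> t s' \<omega> \<and>
      t \<le> poly (time_poly (Seq c1 c2)) B \<and> fits B s' \<and> R s'"
    using exec.Seq[OF 1(1) 2(1)] 1(2) 2(2-4)
    by (intro exI[of _ "t1 + t2"] exI[of _ s2]) (simp add: add_mono)
qed

lemma triple_Cond:
  assumes "triple B (\<lambda>s. P s \<and> aval b s \<noteq> 0) c1 Q" "triple B (\<lambda>s. P s \<and> aval b s = 0) c2 Q"
  shows "triple B P (Cond b c1 c2) Q"
proof (rule tripleI)
  fix s and \<omega> :: "bool stream"
  assume s: "fits B s" "P s"
  note test = acost_plus_num_cost_le[OF s(1), of b]
  show "\<exists>t s'. exec (Cond b c1 c2) s \<omega> t s' \<omega> \<and>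
      t \<le> poly (time_poly (Cond b c1 c2)) B \<and> fits B s' \<and> Q s'"
  proof (cases "aval b s = 0")
    case True
    then obtain t s' where "exec c2 s \<omega> t s' \<omega>" "t \<le> poly (time_poly c2) B" "fits B s'" "Q s'"
      using tripleE[OF assms(2) s(1)] s(2) by blast
    then show ?thesis
      using exec.CondFalse[of b s c2 \<omega> t s' \<omega> c1] True test
      by (intro exI[of _ "acost b s + num_cost (aval b s) + t"] exI[of _ s']) simp
  next
    case False
    then obtain t s' where "exec c1 s \<omega> t s' \<omega>" "t \<le> poly (time_poly c1) B" "fits B s'" "Q s'"
      using tripleE[OF assms(1) s(1)] s(2) by blast
    then show ?thesis
      using exec.CondTrue[of b s c1 \<omega> t s' \<omega> c2] False test
      by (intro exI[of _ "acost b s + num_cost (aval b s) + t"] exI[of _ s']) simp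
  qed
qed

abbreviation Var :: "string \<Rightarrow> aexp" where
  "Var x \<equiv> Cell x (Const 0)"

abbreviation SetVar :: "string \<Rightarrow> aexp \<Rightarrow> com" where
  "SetVar x e \<equiv> Assign x (Const 0) e"

text \<open>Subtraction is truncated, so the loop test is nonzero exactly while the counter is below
  \<open>N\<close>.\<close>

definition For :: "string \<Rightarrow> aexp \<Rightarrow> com \<Rightarrow> com" where
  "For x N c = Seq (SetVar x (Const 0))
     (While (Sub N (Var x)) (Seq c (SetVar x (Add (Var x) (Const 1)))))"

text \<open>The premise on \<open>n\<close> and \<open>B\<close> makes the counter fit into memory
  and bounds the iterations, matching the factor \<open>1 + B\<close> in \<open>time_poly\<close>.
  By \<open>frame\<close> the invariant ignores the counter, which the loop itself
  overwrites.\<close>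

lemma triple_For:
  assumes body: "\<And>k. k < n \<Longrightarrow>
      triple B (\<lambda>s. s x 0 = k \<and> Inv k s) c (\<lambda>s. s x 0 = k \<and> Inv (Suc k) s)"
    and frame: "\<And>k s v. Inv k s \<Longrightarrow> Inv k (store s x 0 v)"
    and N: "\<And>k s. Inv k s \<Longrightarrow> aval N s = n"
    and n: "n \<le> B"
  shows "triple B (Inv 0) (For x N c) (Inv n)"
proof -
  let ?b = "Sub N (Var x)"
  let ?c = "Seq c (SetVar x (Add (Var x) (Const 1)))"
  define T where "T = poly ([:0, 4 * (asize ?b)\<^sup>2:] + time_poly ?c) B"
  have "n < 2 ^ B" using n less_exp[of B] by linarith
  have step: "triple B (\<lambda>s. s x 0 = k \<and> Inv k s) ?c (\<lambda>s. s x 0 = Suc k \<and> Inv (Suc k) s)"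
    if "k < n" for k
    using that \<open>n < 2 ^ B\<close>
    by (intro triple_Seq[OF body] triple_Assign) (auto simp: frame, auto simp: store_def)
  \<comment> \<open>Induction on the number \<open>j\<close> of remaining iterations; the final,
    failing test accounts for the \<open>Suc\<close>.\<close>
  have loop: "\<exists>t s'. exec (While ?b ?c) s \<omega> t s' \<omega> \<and> t \<le> Suc j * T \<and> fits B s' \<and> Inv n s'"
    if "fits B s" "s x 0 + j = n" "Inv (s x 0) s" for s j and \<omega> :: "bool stream"
    using that
  proof (induction j arbitrary: s)
    case 0
    then have "aval ?b s = 0" using N by simp
    from exec.WhileFalse[of ?b s ?c \<omega>, OF this] show ?case
      using acost_plus_num_cost_le[OF 0(1), of ?b] 0 unfolding T_def
      by (intro exI[of _ "acost ?b s + num_cost (aval ?b s)"] exI[of _ s]) simp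
  next
    case (Suc j)
    then have b: "aval ?b s \<noteq> 0" using N by simp
    have "s x 0 < n" using Suc.prems by simp
    from tripleE[OF step[OF this] Suc.prems(1)] Suc.prems
    obtain t1 s1 where 1: "exec ?c s \<omega> t1 s1 \<omega>" "t1 \<le> poly (time_poly ?c) B"
        "fits B s1" "s1 x 0 = Suc (s x 0)" "Inv (Suc (s x 0)) s1"
      by blast
    with Suc.IH[of s1] Suc.prems obtain t2 s2 where
      2: "exec (While ?b ?c) s1 \<omega> t2 s2 \<omega>" "t2 \<le> Suc j * T" "fits B s2" "Inv n s2"
      by auto
    have "acost ?b s + num_cost (aval ?b s) + t1 \<le> T"
      using acost_plus_num_cost_le[OF Suc.prems(1), of ?b] 1(2) by (simp add: T_def)
    then show ?case
      using exec.WhileTrue[OF b 1(1) 2(1)] 2(2-4)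
      by (intro exI[of _ "acost ?b s + num_cost (aval ?b s) + t1 + t2"] exI[of _ s2]) simp
  qed
  have "triple B (\<lambda>s. s x 0 = 0 \<and> Inv 0 s) (While ?b ?c) (Inv n)"
  proof (rule tripleI)
    fix s and \<omega> :: "bool stream"
    assume s: "fits B s" "s x 0 = 0 \<and> Inv 0 s"
    then obtain t s' where *: "exec (While ?b ?c) s \<omega> t s' \<omega>" "t \<le> Suc n * T" "fits B s'" "Inv n s'"
      using loop[of s n \<omega>] by auto
    have "Suc n * T \<le> Suc B * T" using n by (intro mult_le_mono) auto
    moreover have "poly (time_poly (While ?b ?c)) B = Suc B * T"
      by (simp add: T_def algebra_simps)
    ultimately have "t \<le> poly (time_poly (While ?b ?c)) B"
      using *(2) by linarith
    then show "\<exists>t s'. exec (While ?b ?c) s \<omega> t s' \<omega> \<and>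
        t \<le> poly (time_poly (While ?b ?c)) B \<and> fits B s' \<and> Inv n s'"
      using * by blast
  qed
  moreover have "triple B (Inv 0) (SetVar x (Const 0)) (\<lambda>s. s x 0 = 0 \<and> Inv 0 s)"
    by (rule triple_Assign) (auto simp: frame, auto simp: store_def)
  ultimately show ?thesis
    unfolding For_def by (rule triple_Seq[rotated])
qed

lemma triple_weaken:
  assumes "triple B P c Q" "\<And>s. P' s \<Longrightarrow> P s" "\<And>s. Q s \<Longrightarrow> Q' s"
  shows "triple B P' c Q'"
proof (rule tripleI)
  fix s and \<omega> :: "bool stream"
  assume s: "fits B s" "P' s"
  obtain t s' where
    "exec c s \<omega> t s' \<omega>" "t \<le> poly (time_poly c) B" "fits B s'" "Q s'"
    by (rule tripleE[OF assms(1) s(1) assms(2)[OF s(2)]])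
  with assms(3) show "\<exists>t s'. exec c s \<omega> t s' \<omega> \<and>
      t \<le> poly (time_poly c) B \<and> fits B s' \<and> Q' s'"
    by blast
qed

lemma final_mem_eq:
  assumes "exec c s \<omega> t s' \<omega>'"
  shows "final_mem c s \<omega> = s'"
  unfolding final_mem_def
proof (rule the_equality)
  show "\<exists>t \<omega>'. exec c s \<omega> t s' \<omega>'" using assms by blast
  show "r = s'" if "\<exists>t \<omega>'. exec c s \<omega> t r \<omega>'" for r
    using that exec_deterministic[OF assms] by auto
qed

lemma fits_input_mem:
  assumes "input_size xs \<le> B" "B > 0"
  shows "fits B (input_mem xs)"
proof -
  have "xs ! i < 2 ^ B" if "i < length xs" for i
  proof (rule floorlog_leD)
    have "num_cost (xs ! i) \<le> input_size xs"
      unfolding input_size_def using that by (intro member_le_sum_list) auto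
    then show "floorlog 2 (xs ! i) \<le> B"
      using assms by (simp add: num_cost_def)
  qed simp
  then show ?thesis
    using assms by (simp add: fits_def input_mem_def)
qed

text \<open>Every number costs at least 1. Through this the input size bounds the numbers of states
  and signals, and with them the iterations of the loops.\<close>

lemma length_le_input_size: "length xs \<le> input_size xs"
  by (induction xs) (simp_all add: input_size_def num_cost_def)

section \<open>The program\<close>

text \<open>\<open>table v i k\<close> is the \<open>k\<close>-th of the \<open>3 + |\<Sigma>|\<close> numbers describing state \<open>i\<close>
  in the input \<open>v\<close>.\<close>

definition table :: "(nat \<Rightarrow> nat) \<Rightarrow> nat \<Rightarrow> nat \<Rightarrow> nat" where
  "table v i k = v (2 + (i * (3 + v 1) + k))"

definition entry :: "nat \<Rightarrow> aexp" where
  "entry k = Cell ''in'' (Add (Const 2)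
     (Add (Mul (Var ''i'') (Add (Const 3) (Cell ''in'' (Const 1)))) (Const k)))"

definition edge_entry :: aexp where
  "edge_entry = Cell ''in'' (Add (Const 2)
     (Add (Mul (Var ''i'') (Add (Const 3) (Cell ''in'' (Const 1)))) (Add (Const 3) (Var ''j''))))"

text \<open>The product of the denominators, unlike their least common multiple, takes one
  multiplication per state; the partial products form the loop invariant.\<close>

definition common_den :: "(nat \<Rightarrow> nat) \<Rightarrow> nat \<Rightarrow> nat" where
  "common_den v n = (\<Prod>i<n. table v i 2)"

text \<open>For an encoded instance this is the numerator of the probability of state
  \<open>i\<close> over the common denominator if \<open>i\<close> is adjacent to \<open>j\<close>,
  and 0 otherwise.\<close>

definition share :: "(nat \<Rightarrow> nat) \<Rightarrow> nat \<Rightarrow> nat \<Rightarrow> nat" where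
  "share v j i = table v i (3 + j) * (table v i 1 * (common_den v (v 0) div table v i 2))"

definition acceptable_weight :: "(nat \<Rightarrow> nat) \<Rightarrow> nat \<Rightarrow> nat \<Rightarrow> nat" where
  "acceptable_weight v j n = (\<Sum>i<n. table v i 0 * share v j i)"

definition rejectable_weight :: "(nat \<Rightarrow> nat) \<Rightarrow> nat \<Rightarrow> nat \<Rightarrow> nat" where
  "rejectable_weight v j n = (\<Sum>i<n. (1 - table v i 0) * share v j i)"

definition share_exp :: aexp where
  "share_exp = Mul edge_entry (Mul (entry 1) (Div (Var ''D'') (entry 2)))"

definition compute_den :: com where
  "compute_den = Seq (SetVar ''D'' (Const 1))
     (For ''i'' (Cell ''in'' (Const 0)) (SetVar ''D'' (Mul (Var ''D'') (entry 2))))"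

definition compute_weights :: com where
  "compute_weights =
     Seq (SetVar ''A'' (Const 0)) (Seq (SetVar ''R'' (Const 0))
       (For ''i'' (Cell ''in'' (Const 0))
         (Seq (SetVar ''A'' (Add (Var ''A'') (Mul (entry 0) share_exp)))
              (SetVar ''R'' (Add (Var ''R'') (Mul (Sub (Const 1) (entry 0)) share_exp))))))"

text \<open>The truncated difference is nonzero exactly when the signal fails the greedy test. Over
  the denominator \<open>2 * d^2 - 1\<close> the two numerators stand for
  \<open>accept_fraction d\<close> and 1.\<close>

definition decide_signal :: "nat \<Rightarrow> com" where
  "decide_signal d =
     Seq compute_weights
       (Seq (Assign ''den'' (Var ''j'') (Const (2 * d\<^sup>2 - 1)))
         (Cond (Sub (Mul (Const d) (Var ''R'')) (Var ''A''))
           (Assign ''num'' (Var ''j'') (Const (d\<^sup>2 - 1)))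
           (Assign ''num'' (Var ''j'') (Const (2 * d\<^sup>2 - 1)))))"

definition greedy_program :: "nat \<Rightarrow> com" where
  "greedy_program d = Seq compute_den (For ''j'' (Cell ''in'' (Const 1)) (decide_signal d))"

lemma aval_entry: "aval (entry k) s = table (s ''in'') (s ''i'' 0) k"
  by (simp add: entry_def table_def)

lemma aval_edge_entry: "aval edge_entry s = table (s ''in'') (s ''i'' 0) (3 + s ''j'' 0)"
  by (simp add: edge_entry_def table_def)

lemma aval_share_exp:
  "s ''D'' 0 = common_den (s ''in'') (s ''in'' 0) \<Longrightarrow>
   aval share_exp s = share (s ''in'') (s ''j'' 0) (s ''i'' 0)"
  by (simp add: share_exp_def aval_edge_entry aval_entry share_def)

section \<open>Correctness of the program\<close>

lemma compute_den_correct: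
  assumes "v 0 \<le> B" "\<And>i. i \<le> v 0 \<Longrightarrow> common_den v i < 2 ^ B"
  shows "triple B (\<lambda>s. s ''in'' = v) compute_den
           (\<lambda>s. s ''in'' = v \<and> s ''D'' 0 = common_den v (v 0))"
proof -
  define Inv where "Inv i s \<longleftrightarrow> s ''in'' = v \<and> s ''D'' 0 = common_den v i" for i and s :: mem
  have "triple B (Inv 0) (For ''i'' (Cell ''in'' (Const 0)) (SetVar ''D'' (Mul (Var ''D'') (entry 2))))
      (Inv (v 0))"
  proof (intro triple_For[where Inv = Inv] triple_Assign)
    fix k s assume k: "k < v 0" and s: "fits B s" "s ''i'' 0 = k \<and> Inv k s"
    then have "aval (Mul (Var ''D'') (entry 2)) s = common_den v (Suc k)"
      by (simp add: Inv_def aval_entry common_den_def)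
    then show "aval (Mul (Var ''D'') (entry 2)) s < 2 ^ B \<and>
        (store s ''D'' (aval (Const 0) s) (aval (Mul (Var ''D'') (entry 2)) s) ''i'' 0 = k \<and>
         Inv (Suc k) (store s ''D'' (aval (Const 0) s) (aval (Mul (Var ''D'') (entry 2)) s)))"
      using s k assms(2)[of "Suc k"] by (simp add: Inv_def store_def)
  qed (auto simp: Inv_def store_def assms)
  moreover have "triple B (\<lambda>s. s ''in'' = v) (SetVar ''D'' (Const 1)) (Inv 0)"
    by (rule triple_Assign) (auto simp: Inv_def store_def common_den_def fits_def
        simp flip: One_nat_def)
  ultimately show ?thesis
    unfolding compute_den_def Inv_def by (rule triple_Seq[rotated])
qed

text \<open>The predicate \<open>P\<close> carries what the enclosing loop over the signals knows
  through the loop over the states; it has to survive writes to the three variables changed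
  there.\<close>

lemma compute_weights_correct:
  assumes "v 0 \<le> B"
    and "\<And>i. i \<le> v 0 \<Longrightarrow> acceptable_weight v j i < 2 ^ B"
    and "\<And>i. i \<le> v 0 \<Longrightarrow> rejectable_weight v j i < 2 ^ B"
    and frame: "\<And>s x k. P s \<Longrightarrow> x \<in> {''A'', ''R'', ''i''} \<Longrightarrow> P (store s x 0 k)"
    and P: "\<And>s. P s \<Longrightarrow> s ''in'' = v \<and> s ''j'' 0 = j \<and> s ''D'' 0 = common_den v (v 0)"
  shows "triple B P compute_weights
    (\<lambda>s. P s \<and> s ''A'' 0 = acceptable_weight v j (v 0) \<and> s ''R'' 0 = rejectable_weight v j (v 0))"
proof -
  define Inv where "Inv i s \<longleftrightarrow> P s \<and> s ''A'' 0 = acceptable_weight v j i \<and>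
    s ''R'' 0 = rejectable_weight v j i" for i s
  let ?A = "Add (Var ''A'') (Mul (entry 0) share_exp)"
  let ?R = "Add (Var ''R'') (Mul (Sub (Const 1) (entry 0)) share_exp)"
  have "triple B (Inv 0) (For ''i'' (Cell ''in'' (Const 0)) (Seq (SetVar ''A'' ?A) (SetVar ''R'' ?R)))
      (Inv (v 0))"
  proof (rule triple_For[where Inv = Inv])
    fix k assume k: "k < v 0"
    \<comment> \<open>Between the two assignments the accumulator \<open>A\<close> is one state
      ahead of \<open>R\<close>.\<close>
    define Mid where "Mid s \<longleftrightarrow> s ''i'' 0 = k \<and> P s \<and> s ''A'' 0 = acceptable_weight v j (Suc k) \<and>
      s ''R'' 0 = rejectable_weight v j k" for s
    have "triple B (\<lambda>s. s ''i'' 0 = k \<and> Inv k s) (SetVar ''A'' ?A) Mid"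
    proof (rule triple_Assign)
      fix s assume s: "fits B s" "s ''i'' 0 = k \<and> Inv k s"
      then have *: "aval ?A s = acceptable_weight v j (Suc k)"
        using P[of s] by (simp add: Inv_def aval_entry aval_share_exp acceptable_weight_def)
      have "P (store s ''A'' 0 x)" for x using s by (intro frame) (auto simp: Inv_def)
      then show "aval ?A s < 2 ^ B \<and> Mid (store s ''A'' (aval (Const 0) s) (aval ?A s))"
        using s k assms(2)[of "Suc k"] unfolding * by (simp add: Inv_def Mid_def) (simp add: store_def)
    qed
    moreover have "triple B Mid (SetVar ''R'' ?R) (\<lambda>s. s ''i'' 0 = k \<and> Inv (Suc k) s)"
    proof (rule triple_Assign)
      fix s assume s: "fits B s" "Mid s"
      then have *: "aval ?R s = rejectable_weight v j (Suc k)"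
        using P[of s] by (simp add: Mid_def aval_entry aval_share_exp rejectable_weight_def)
      have "P (store s ''R'' 0 x)" for x using s by (intro frame) (auto simp: Mid_def)
      then show "aval ?R s < 2 ^ B \<and> (store s ''R'' (aval (Const 0) s) (aval ?R s) ''i'' 0 = k \<and>
          Inv (Suc k) (store s ''R'' (aval (Const 0) s) (aval ?R s)))"
        using s k assms(3)[of "Suc k"] unfolding * by (simp add: Inv_def Mid_def) (simp add: store_def)
    qed
    ultimately show "triple B (\<lambda>s. s ''i'' 0 = k \<and> Inv k s) (Seq (SetVar ''A'' ?A) (SetVar ''R'' ?R))
        (\<lambda>s. s ''i'' 0 = k \<and> Inv (Suc k) s)"
      by (rule triple_Seq)
  next
    fix k s x assume "Inv k s"
    then show "Inv k (store s ''i'' 0 x)"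
      using frame[of s "''i''"] by (simp add: Inv_def) (simp add: store_def)
  next
    fix k s assume "Inv k s"
    then show "aval (Cell ''in'' (Const 0)) s = v 0" using P[of s] by (simp add: Inv_def)
  qed (rule assms(1))
  moreover have "triple B P (SetVar ''A'' (Const 0)) (\<lambda>s. P s \<and> s ''A'' 0 = 0)"
    using frame by (intro triple_Assign) (simp, simp add: store_def)
  moreover have "triple B (\<lambda>s. P s \<and> s ''A'' 0 = 0) (SetVar ''R'' (Const 0)) (Inv 0)"
    using frame by (intro triple_Assign)
      (simp add: Inv_def acceptable_weight_def rejectable_weight_def, simp add: store_def)
  ultimately show ?thesis
    unfolding compute_weights_def Inv_def by (blast intro: triple_Seq)
qed

definition correct_output :: "nat \<Rightarrow> (nat \<Rightarrow> nat) \<Rightarrow> nat \<Rightarrow> mem \<Rightarrow> bool" where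
  "correct_output d v j s \<longleftrightarrow> s ''den'' j = 2 * d\<^sup>2 - 1 \<and>
     s ''num'' j = (if d * rejectable_weight v j (v 0) \<le> acceptable_weight v j (v 0)
                    then 2 * d\<^sup>2 - 1 else d\<^sup>2 - 1)"

text \<open>Size bounds enter as premises, which separates the logic of the program from the
  estimates of its numbers.\<close>

lemma greedy_program_correct:
  assumes "v 0 \<le> B" "v 1 \<le> B" "2 * d\<^sup>2 < 2 ^ B"
    and "\<And>i. i \<le> v 0 \<Longrightarrow> common_den v i < 2 ^ B"
    and "\<And>i j. i \<le> v 0 \<Longrightarrow> acceptable_weight v j i < 2 ^ B"
    and "\<And>i j. i \<le> v 0 \<Longrightarrow> rejectable_weight v j i < 2 ^ B"
  shows "triple B (\<lambda>s. s ''in'' = v) (greedy_program d) (\<lambda>s. \<forall>j<v 1. correct_output d v j s)"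
proof -
  define Inv where "Inv k s \<longleftrightarrow> s ''in'' = v \<and> s ''D'' 0 = common_den v (v 0) \<and>
    (\<forall>j<k. correct_output d v j s)" for k s
  \<comment> \<open>The invariant reads only these four arrays, so writes to the working variables
    preserve it.\<close>
  have frame: "Inv k (store s x i y)"
    if "Inv k s" "x \<notin> {''in'', ''D'', ''den'', ''num''}" for k s x i y
    using that by (auto simp: Inv_def correct_output_def store_def)
  have bounds: "2 * d\<^sup>2 - 1 < 2 ^ B" "d\<^sup>2 - 1 < 2 ^ B"
    using assms(3) by linarith+
  have "triple B (Inv 0) (For ''j'' (Cell ''in'' (Const 1)) (decide_signal d)) (Inv (v 1))"
  proof (rule triple_For[where Inv = Inv])
    fix k assume k: "k < v 1"
    define W where "W s \<longleftrightarrow> (s ''j'' 0 = k \<and> Inv k s) \<and>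
      s ''A'' 0 = acceptable_weight v k (v 0) \<and> s ''R'' 0 = rejectable_weight v k (v 0)" for s
    have "triple B (\<lambda>s. s ''j'' 0 = k \<and> Inv k s) compute_weights W"
      unfolding W_def
    proof (rule compute_weights_correct[OF assms(1,5,6)])
      show "store s x 0 y ''j'' 0 = k \<and> Inv k (store s x 0 y)"
        if "s ''j'' 0 = k \<and> Inv k s" "x \<in> {''A'', ''R'', ''i''}" for s x y
        using that frame[of k s x] by (auto simp: store_def)
    qed (auto simp: Inv_def)
    moreover have "triple B W (Assign ''den'' (Var ''j'') (Const (2 * d\<^sup>2 - 1)))
        (\<lambda>s. W s \<and> s ''den'' k = 2 * d\<^sup>2 - 1)"
      using bounds by (intro triple_Assign) (auto simp: W_def Inv_def correct_output_def store_def)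
    moreover have "triple B (\<lambda>s. W s \<and> s ''den'' k = 2 * d\<^sup>2 - 1)
        (Cond (Sub (Mul (Const d) (Var ''R'')) (Var ''A''))
           (Assign ''num'' (Var ''j'') (Const (d\<^sup>2 - 1)))
           (Assign ''num'' (Var ''j'') (Const (2 * d\<^sup>2 - 1))))
        (\<lambda>s. s ''j'' 0 = k \<and> Inv (Suc k) s)"
      using bounds by (intro triple_Cond triple_Assign)
        (auto simp: W_def Inv_def correct_output_def store_def less_Suc_eq)
    ultimately show "triple B (\<lambda>s. s ''j'' 0 = k \<and> Inv k s) (decide_signal d)
       (\<lambda>s. s ''j'' 0 = k \<and> Inv (Suc k) s)"
      unfolding decide_signal_def by (blast intro: triple_Seq)
  next
    fix k s y assume "Inv k s"
    then show "Inv k (store s ''j'' 0 y)" by (rule frame) simp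
  next
    fix k s assume "Inv k s"
    then show "aval (Cell ''in'' (Const 1)) s = v 1" by (simp add: Inv_def)
  qed (rule assms(2))
  then have "triple B (\<lambda>s. s ''in'' = v \<and> s ''D'' 0 = common_den v (v 0))
    (For ''j'' (Cell ''in'' (Const 1)) (decide_signal d))
    (\<lambda>s. \<forall>j<v 1. correct_output d v j s)"
    by (rule triple_weaken) (simp_all add: Inv_def)
  moreover have "triple B (\<lambda>s. s ''in'' = v) compute_den
      (\<lambda>s. s ''in'' = v \<and> s ''D'' 0 = common_den v (v 0))"
    using assms(1,4) by (rule compute_den_correct)
  ultimately show ?thesis
    unfolding greedy_program_def by (rule triple_Seq[rotated])
qed

section \<open>Lengths of the computed numbers\<close>

text \<open>The common denominator is a product of at most \<open>L\<close> factors of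
  \<open>L\<close> bits. A summand of a weight has three further factors of at most
  \<open>2 ^ L\<close>, and there are at most \<open>2 ^ L\<close> summands, which accounts for
  \<open>4 * L\<close>.\<close>

lemma
  assumes "\<And>x. v x < 2 ^ L" "v 0 \<le> L" "i \<le> v 0"
  shows common_den_less: "common_den v i < 2 ^ (L * L + 1)"
    and acceptable_weight_less: "acceptable_weight v j i < 2 ^ (L * L + 4 * L + 1)"
    and rejectable_weight_less: "rejectable_weight v j i < 2 ^ (L * L + 4 * L + 1)"
proof -
  have table: "table v k l \<le> 2 ^ L" for k l
    using assms(1) by (simp add: table_def less_imp_le)
  have den: "common_den v k \<le> 2 ^ (L * L)" if "k \<le> v 0" for k
  proof -
    have "common_den v k \<le> (\<Prod>i<k. 2 ^ L)"
      unfolding common_den_def by (intro prod_mono) (simp add: table)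
    also have "\<dots> = 2 ^ (L * k)" by (simp add: power_mult)
    also have "\<dots> \<le> 2 ^ (L * L)" using that assms(2) by (intro power_increasing) auto
    finally show ?thesis .
  qed
  from den[OF assms(3)] show "common_den v i < 2 ^ (L * L + 1)"
    by (rule le_less_trans) simp
  have share: "share v j k \<le> 2 ^ L * (2 ^ L * 2 ^ (L * L))" for k
    unfolding share_def using den[of "v 0"]
    by (intro mult_le_mono table) (auto intro: order_trans[OF div_le_dividend])
  have "i \<le> 2 ^ L" using assms(2,3) less_exp[of L] by linarith
  have sum: "(\<Sum>k<i. w k * share v j k) < 2 ^ (L * L + 4 * L + 1)" if "\<And>k. w k \<le> 2 ^ L" for w
  proof -
    have "(\<Sum>k<i. w k * share v j k) \<le> of_nat (card {..<i}) * (2 ^ L * (2 ^ L * (2 ^ L * 2 ^ (L * L))))"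
      by (intro sum_bounded_above mult_le_mono share that)
    also have "\<dots> \<le> 2 ^ L * (2 ^ L * (2 ^ L * (2 ^ L * 2 ^ (L * L))))"
      using \<open>i \<le> 2 ^ L\<close> by (intro mult_le_mono1) simp
    also have "\<dots> = 2 ^ (L * L + 4 * L)"
      by (simp add: power_add[symmetric])
    also have "\<dots> < 2 ^ (L * L + 4 * L + 1)" by simp
    finally show ?thesis .
  qed
  show "acceptable_weight v j i < 2 ^ (L * L + 4 * L + 1)"
    unfolding acceptable_weight_def by (intro sum table)
  have "1 - table v k 0 \<le> 2 ^ L" for k
    by (rule order_trans[OF diff_le_self]) simp
  then show "rejectable_weight v j i < 2 ^ (L * L + 4 * L + 1)"
    unfolding rejectable_weight_def by (rule sum)
qed

section \<open>Reading the encoded instance\<close>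

text \<open>Row-major indexing into a table with \<open>n\<close> rows of common length
  \<open>l\<close>.\<close>

lemma concat_map_uniform:
  assumes "\<And>i. i < n \<Longrightarrow> length (f i) = l"
  shows length_concat_map_uniform: "length (concat (map f [0..<n])) = n * l"
    and nth_concat_map_uniform:
      "i < n \<Longrightarrow> k < l \<Longrightarrow> concat (map f [0..<n]) ! (i * l + k) = f i ! k"
proof -
  show len: "length (concat (map f [0..<n])) = n * l"
    using assms by (induction n) auto
  show "concat (map f [0..<n]) ! (i * l + k) = f i ! k" if "i < n" "k < l"
    using assms that len
  proof (induction n)
    case (Suc n)
    have len: "length (concat (map f [0..<n])) = n * l"
      using Suc.prems(1) by (induction n) auto
    show ?case
    proof (cases "i = n")
      case True
      then show ?thesis using len by (simp add: nth_append)
    next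
      case False
      then have "Suc i * l \<le> n * l" using Suc.prems by (intro mult_le_mono) auto
      then have "i * l + k < n * l" using Suc.prems by simp
      then show ?thesis using Suc False len by (simp add: nth_append)
    qed
  qed simp
qed

text \<open>These facts recover the instance from the input array through \<open>table\<close> and
  hide the layout of \<open>encode I\<close> from the later arguments.\<close>

lemma
  fixes I defines "n \<equiv> card (states I)" and "m \<equiv> card (signals I)"
    and "v \<equiv> input_mem (encode I) ''in''"
  shows length_encode: "length (encode I) = 2 + n * (3 + m)"
    and input_card_states: "v 0 = n"
    and input_card_signals: "v 1 = m"
    and table_acceptable: "\<theta> < n \<Longrightarrow> table v \<theta> 0 = of_bool (\<theta> \<in> acceptable I)"
    and table_numerator: "\<theta> < n \<Longrightarrow> table v \<theta> 1 = nat (fst (quotient_of (state_prob I \<theta>)))"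
    and table_denominator: "\<theta> < n \<Longrightarrow> table v \<theta> 2 = nat (snd (quotient_of (state_prob I \<theta>)))"
    and table_edge: "\<theta> < n \<Longrightarrow> \<sigma> < m \<Longrightarrow> table v \<theta> (3 + \<sigma>) = of_bool ((\<theta>, \<sigma>) \<in> edges I)"
proof -
  define f where "f \<theta> = [of_bool (\<theta> \<in> acceptable I),
          nat (fst (quotient_of (state_prob I \<theta>))),
          nat (snd (quotient_of (state_prob I \<theta>)))] @
         map (\<lambda>\<sigma>. of_bool ((\<theta>, \<sigma>) \<in> edges I)) [0..<m]" for \<theta>
  have enc: "encode I = [n, m] @ concat (map f [0..<n])"
    by (simp add: encode_def f_def[abs_def] n_def m_def)
  have "length (f \<theta>) = 3 + m" for \<theta> by (simp add: f_def)
  note len = length_concat_map_uniform[of n f, OF this]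
    and nth = nth_concat_map_uniform[of n f, OF this]
  show *: "length (encode I) = 2 + n * (3 + m)" using len by (simp add: enc)
  show "v 0 = n" "v 1 = m"
    by (simp_all add: v_def input_mem_def enc)
  have "table v \<theta> k = f \<theta> ! k" if "\<theta> < n" "k < 3 + m" for \<theta> k
  proof -
    have "Suc \<theta> * (3 + m) \<le> n * (3 + m)" using that by (intro mult_le_mono) auto
    then have "\<theta> * (3 + m) + k < n * (3 + m)" using that by simp
    then show ?thesis
      using * nth[OF that] \<open>v 1 = m\<close> unfolding table_def
      by (simp add: v_def input_mem_def) (simp add: enc)
  qed
  then show "\<theta> < n \<Longrightarrow> table v \<theta> 0 = of_bool (\<theta> \<in> acceptable I)"
    "\<theta> < n \<Longrightarrow> table v \<theta> 1 = nat (fst (quotient_of (state_prob I \<theta>)))"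
    "\<theta> < n \<Longrightarrow> table v \<theta> 2 = nat (snd (quotient_of (state_prob I \<theta>)))"
    "\<theta> < n \<Longrightarrow> \<sigma> < m \<Longrightarrow> table v \<theta> (3 + \<sigma>) = of_bool ((\<theta>, \<sigma>) \<in> edges I)"
    by (auto simp: f_def nth_append)
qed

text \<open>Scaling by the common denominator turns the weights into integers without rounding, so
  the program compares them exactly.\<close>

lemma
  assumes I: "delegation_instance I" "numbered I" and \<sigma>: "\<sigma> \<in> signals I"
  defines "v \<equiv> input_mem (encode I) ''in''"
  shows common_den_pos: "common_den v (v 0) > 0"
    and acceptable_weight_eq: "real (acceptable_weight v \<sigma> (v 0)) =
      real (common_den v (v 0)) * signal_weight I (acceptable I) \<sigma>"
    and rejectable_weight_eq: "real (rejectable_weight v \<sigma> (v 0)) =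
      real (common_den v (v 0)) * signal_weight I (rejectable I) \<sigma>"
proof -
  define D where "D = common_den v (v 0)"
  define n where "n = card (states I)"
  have n: "v 0 = n" "states I = {..<n}" and m: "\<sigma> < card (signals I)"
    using I(2) \<sigma> by (auto simp: v_def n_def input_card_states numbered_def)
  have den_pos: "table v \<theta> 2 > 0" if "\<theta> < n" for \<theta>
    using that quotient_of_denom_pos' by (simp add: table_denominator v_def n_def)
  show "common_den v (v 0) > 0"
    unfolding common_den_def using den_pos n by (auto intro!: prod_pos)
  have share: "real (share v \<sigma> \<theta>) =
      real D * (of_rat (state_prob I \<theta>) * of_bool ((\<theta>, \<sigma>) \<in> edges I))" if "\<theta> < n" for \<theta>
  proof -
    obtain p q where pq: "quotient_of (state_prob I \<theta>) = (p, q)" by fastforce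
    have "q > 0" using pq by (rule quotient_of_denom_pos)
    have prob: "state_prob I \<theta> = of_int p / of_int q" using pq by (rule quotient_of_div)
    have "state_prob I \<theta> > 0" using I(1) n that by (auto simp: delegation_instance_def)
    \<comment> \<open>A positive numerator loses nothing under \<open>nat\<close>.\<close>
    with prob \<open>q > 0\<close> have "p > 0" by (simp add: zero_less_divide_iff)
    have t: "table v \<theta> 1 = nat p" "table v \<theta> 2 = nat q"
      using that pq by (simp_all add: table_numerator table_denominator v_def n_def del: One_nat_def)
    \<comment> \<open>Each denominator is a factor of the product, so the integer division in
      \<open>share\<close> is exact.\<close>
    have "table v \<theta> 2 dvd D"
      unfolding D_def common_den_def using that n by (intro dvd_prodI) auto
    then have "real (D div table v \<theta> 2) = D / q"
      using \<open>q > 0\<close> by (simp add: real_of_nat_div t)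
    moreover have "real_of_rat (state_prob I \<theta>) = p / q"
      by (simp add: prob of_rat_divide)
    ultimately show ?thesis
      using \<open>p > 0\<close> that m table_edge[of \<theta> I \<sigma>]
      by (simp add: share_def D_def[symmetric] t v_def[symmetric] n_def[symmetric] del: One_nat_def)
  qed
  have weight: "(\<Sum>\<theta><n. of_bool (\<theta> \<in> X) * real (share v \<sigma> \<theta>)) = real D * signal_weight I X \<sigma>"
    if "X \<subseteq> states I" for X
  proof -
    have "(\<Sum>\<theta><n. of_bool (\<theta> \<in> X) * real (share v \<sigma> \<theta>)) = (\<Sum>\<theta>\<in>X. real (share v \<sigma> \<theta>))"
      using that n by (intro sum.mono_neutral_cong_right) auto
    also have "\<dots> = real D * signal_weight I X \<sigma>"
      unfolding signal_weight_def sum_distrib_left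
      by (intro sum.cong refl share) (use that n in auto)
    finally show ?thesis .
  qed
  have acc: "table v \<theta> 0 = of_bool (\<theta> \<in> acceptable I)" if "\<theta> < n" for \<theta>
    using that by (simp add: table_acceptable v_def n_def)
  show "real (acceptable_weight v \<sigma> (v 0)) =
      real (common_den v (v 0)) * signal_weight I (acceptable I) \<sigma>"
    using weight[OF acceptable_states] acc by (simp add: acceptable_weight_def n D_def)
  \<comment> \<open>Acceptable and rejectable states partition the states, so the complement of one
    indicator is the other.\<close>
  have "1 - table v \<theta> 0 = of_bool (\<theta> \<in> rejectable I)" if "\<theta> < n" for \<theta>
  proof -
    have "\<theta> \<in> rejectable I \<longleftrightarrow> \<theta> \<notin> acceptable I"
      using that n I(1) by (auto simp: delegation_instance_def states_def)
    then show ?thesis using acc[OF that] by simp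
  qed
  then show "real (rejectable_weight v \<sigma> (v 0)) =
      real (common_den v (v 0)) * signal_weight I (rejectable I) \<sigma>"
    using weight[OF rejectable_states] by (simp add: rejectable_weight_def n D_def)
qed

section \<open>From the computed output to the approximation guarantee\<close>

text \<open>Cancelling the positive common denominator in the test of the program leaves the
  inequality that defines \<open>greedy_signals\<close>.\<close>

lemma decode_correct_output:
  assumes "delegation_instance I" "numbered I" "\<sigma> \<in> signals I" "d \<ge> 1"
    and "correct_output d (input_mem (encode I) ''in'') \<sigma> s"
  shows "decode_scheme s \<sigma> = greedy_scheme d I \<sigma>"
proof -
  define v where "v = input_mem (encode I) ''in''"
  have "d * rejectable_weight v \<sigma> (v 0) \<le> acceptable_weight v \<sigma> (v 0) \<longleftrightarrow>
      real d * real (rejectable_weight v \<sigma> (v 0)) \<le> real (acceptable_weight v \<sigma> (v 0))"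
    unfolding of_nat_mult[symmetric] of_nat_le_iff ..
  also have "\<dots> \<longleftrightarrow> real (common_den v (v 0)) * (real d * signal_weight I (rejectable I) \<sigma>)
      \<le> real (common_den v (v 0)) * signal_weight I (acceptable I) \<sigma>"
    unfolding v_def acceptable_weight_eq[OF assms(1-3)] rejectable_weight_eq[OF assms(1-3)]
    by (simp only: mult_ac)
  also have "\<dots> \<longleftrightarrow> \<sigma> \<in> greedy_signals d I"
    using common_den_pos[OF assms(1-3)] by (simp add: v_def greedy_signals_def)
  finally have *: "d * rejectable_weight v \<sigma> (v 0) \<le> acceptable_weight v \<sigma> (v 0) \<longleftrightarrow>
    \<sigma> \<in> greedy_signals d I" .
  \<comment> \<open>For positive \<open>d\<close> the truncated subtractions agree with the real
    ones, and the output denominator is nonzero.\<close>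
  have "d\<^sup>2 \<ge> 1" "real d ^ 2 \<ge> 1" using \<open>d \<ge> 1\<close> by simp_all
  then have num: "real (2 * d\<^sup>2 - 1) = 2 * real d ^ 2 - 1" "real (d\<^sup>2 - 1) = real d ^ 2 - 1"
    and "2 * real d ^ 2 - 1 \<noteq> 0"
    by (simp_all add: of_nat_diff)
  have "s ''den'' \<sigma> = 2 * d\<^sup>2 - 1"
    "s ''num'' \<sigma> = (if \<sigma> \<in> greedy_signals d I then 2 * d\<^sup>2 - 1 else d\<^sup>2 - 1)"
    using assms(5) unfolding correct_output_def v_def[symmetric] * by simp_all
  then show ?thesis
    using \<open>2 * real d ^ 2 - 1 \<noteq> 0\<close>
    by (simp only: decode_scheme_def greedy_scheme_def accept_fraction_def if_distrib[of real] num) simp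
qed

text \<open>The output is known to match \<open>greedy_scheme\<close> only at the signals of the
  instance; the utility reads no other values.\<close>

lemma receiver_utility_cong:
  assumes "delegation_instance I" "\<And>\<sigma>. \<sigma> \<in> signals I \<Longrightarrow> \<psi> \<sigma> = \<phi> \<sigma>"
  shows "receiver_utility I \<psi> = receiver_utility I \<phi>"
proof -
  have "\<psi> ` nbrs I \<theta> = \<phi> ` nbrs I \<theta>" if "\<theta> \<in> states I" for \<theta>
    using nbrs_subset[OF assms(1) that] assms(2) by (intro image_cong) auto
  then show ?thesis
    unfolding receiver_utility_def
    by (intro arg_cong2[where f = "(+)"] sum.cong) (simp_all add: states_def)
qed

text \<open>The factor \<open>L * L\<close> is a crude bound for the length of the common denominator, a product of
  at most \<open>L\<close> numbers of length at most \<open>L\<close>.\<close>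

definition bit_bound :: "nat \<Rightarrow> nat \<Rightarrow> nat" where
  "bit_bound d L = L * L + 4 * L + 1 + 2 * d\<^sup>2"

lemma greedy_program_run:
  assumes I: "delegation_instance I" "numbered I" and "d \<ge> 1"
  obtains t s' where "exec (greedy_program d) (input_mem (encode I)) \<omega> t s' \<omega>"
    and "t \<le> poly (time_poly (greedy_program d)) (bit_bound d (input_size (encode I)))"
    and "\<forall>\<sigma>\<in>signals I. s' ''den'' \<sigma> > 0 \<and> decode_scheme s' \<sigma> = greedy_scheme d I \<sigma>"
proof -
  define L where "L = input_size (encode I)"
  define B where "B = bit_bound d L"
  define v where "v = input_mem (encode I) ''in''"
  have len: "2 + card (states I) * (3 + card (signals I)) \<le> L"
    using length_le_input_size[of "encode I"] by (simp add: L_def length_encode)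
  \<comment> \<open>The probabilities sum to 1, so there is a state; with at least one adjacency row
    the length of the input also bounds the number of signals.\<close>
  have "states I \<noteq> {}" "finite (states I)"
    using I(1) by (auto simp: delegation_instance_def)
  then have "card (states I) \<ge> 1" by (simp add: Suc_le_eq card_gt_0_iff)
  then have "card (signals I) \<le> card (states I) * card (signals I)" by simp
  with len have "card (states I) \<le> L" "card (signals I) \<le> L" and "L > 0"
    unfolding distrib_left by linarith+
  then have nm: "v 0 \<le> L" "v 1 \<le> L"
    by (simp_all add: v_def input_card_states input_card_signals del: One_nat_def)
  have v: "v x < 2 ^ L" for x
    using fits_input_mem[of "encode I" L] \<open>L > 0\<close> by (simp add: L_def fits_def v_def)
  have "triple B (\<lambda>s. s ''in'' = v) (greedy_program d) (\<lambda>s. \<forall>j<v 1. correct_output d v j s)"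
  proof (rule greedy_program_correct)
    show "v 0 \<le> B" "v 1 \<le> B" using nm by (simp_all add: B_def bit_bound_def)
    have "2 * d\<^sup>2 \<le> B" by (simp add: B_def bit_bound_def)
    then show "2 * d\<^sup>2 < 2 ^ B" using less_exp[of B] by linarith
    have le: "(2::nat) ^ (L * L + 1) \<le> 2 ^ B" "(2::nat) ^ (L * L + 4 * L + 1) \<le> 2 ^ B"
      by (intro power_increasing; simp add: B_def bit_bound_def)+
    fix i j assume "i \<le> v 0"
    note less = common_den_less[of v L i, OF v nm(1) this]
      acceptable_weight_less[of v L i j, OF v nm(1) this]
      rejectable_weight_less[of v L i j, OF v nm(1) this]
    show "common_den v i < 2 ^ B" "acceptable_weight v j i < 2 ^ B" "rejectable_weight v j i < 2 ^ B"
      using less_le_trans[OF less(1) le(1)] less_le_trans[OF less(2) le(2)]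
        less_le_trans[OF less(3) le(2)] .
  qed
  moreover have "fits B (input_mem (encode I))"
    by (rule fits_input_mem) (simp_all add: B_def bit_bound_def L_def)
  ultimately obtain t s' where *: "exec (greedy_program d) (input_mem (encode I)) \<omega> t s' \<omega>"
      "t \<le> poly (time_poly (greedy_program d)) B" "\<forall>j<v 1. correct_output d v j s'"
    unfolding triple_def v_def by blast
  have "\<forall>\<sigma>\<in>signals I. s' ''den'' \<sigma> > 0 \<and> decode_scheme s' \<sigma> = greedy_scheme d I \<sigma>"
  proof
    fix \<sigma> assume \<sigma>: "\<sigma> \<in> signals I"
    then have "\<sigma> < v 1" using I(2) by (auto simp: numbered_def v_def input_card_signals simp del: One_nat_def)
    with *(3) have c: "correct_output d v \<sigma> s'" by blast
    have "d\<^sup>2 \<ge> 1" using \<open>d \<ge> 1\<close> by simp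
    then show "s' ''den'' \<sigma> > 0 \<and> decode_scheme s' \<sigma> = greedy_scheme d I \<sigma>"
      using c decode_correct_output[OF I \<sigma> \<open>d \<ge> 1\<close>, of s'] by (simp add: correct_output_def v_def)
  qed
  then show ?thesis
    using * that unfolding B_def L_def by blast
qed

theorem theorem4p6:
  fixes d :: nat
  assumes "d \<ge> 1"
  shows "\<exists>c. poly_time_on (degree_instances d) c \<and>
             approximates_on (degree_instances d) (2 - 1 / (real d)\<^sup>2) c"
proof (intro exI conjI)
  \<comment> \<open>The coefficients are those of \<open>bit_bound d L\<close> as a polynomial in
    \<open>L\<close>; the fixed \<open>d\<close> enters as a constant.\<close>
  define p where "p = pcompose (time_poly (greedy_program d)) [:1 + 2 * d\<^sup>2, 4, 1:]"
  have p: "poly p L = poly (time_poly (greedy_program d)) (bit_bound d L)" for L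
    by (simp add: p_def poly_pcompose bit_bound_def algebra_simps)
  show "poly_time_on (degree_instances d) (greedy_program d)"
    unfolding poly_time_on_def
  proof (intro exI[of _ p] ballI allI)
    fix I \<omega> assume "I \<in> degree_instances d"
    then have I: "delegation_instance I" "numbered I" by (auto simp: degree_instances_def)
    obtain t s' where "exec (greedy_program d) (input_mem (encode I)) \<omega> t s' \<omega>"
      "t \<le> poly p (input_size (encode I))"
      unfolding p by (rule greedy_program_run[OF I assms])
    then show "\<exists>t s' \<omega>'. exec (greedy_program d) (input_mem (encode I)) \<omega> t s' \<omega>' \<and>
        t \<le> poly p (input_size (encode I))" by blast
  qed
  show "approximates_on (degree_instances d) (2 - 1 / (real d)\<^sup>2) (greedy_program d)"
    unfolding approximates_on_def
  proof (intro ballI conjI allI)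
    fix I assume "I \<in> degree_instances d"
    then have I: "delegation_instance I" "numbered I" and deg: "degree_states d I"
      by (auto simp: degree_instances_def)
    have out: "\<forall>\<sigma>\<in>signals I. output_mem (greedy_program d) I \<omega> ''den'' \<sigma> > 0 \<and>
        decode_scheme (output_mem (greedy_program d) I \<omega>) \<sigma> = greedy_scheme d I \<sigma>" for \<omega>
    proof -
      obtain t s' where "exec (greedy_program d) (input_mem (encode I)) \<omega> t s' \<omega>"
        and s': "\<forall>\<sigma>\<in>signals I. s' ''den'' \<sigma> > 0 \<and> decode_scheme s' \<sigma> = greedy_scheme d I \<sigma>"
        by (rule greedy_program_run[OF I assms])
      then have "output_mem (greedy_program d) I \<omega> = s'"
        unfolding output_mem_def by (intro final_mem_eq)
      with s' show ?thesis by simp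
    qed
    show "valid_output I (output_mem (greedy_program d) I \<omega>)" for \<omega>
      using out[of \<omega>] accept_fraction_bounds[OF assms]
      by (simp add: valid_output_def decision_scheme_def greedy_scheme_def)
    have eq: "receiver_utility I (decode_scheme (output_mem (greedy_program d) I \<omega>)) =
        receiver_utility I (greedy_scheme d I)" for \<omega>
      using out[of \<omega>] by (intro receiver_utility_cong I) auto
    \<comment> \<open>The utility is the same for all coin sequences, and the integral of a constant
      over a probability space is that constant.\<close>
    interpret prob_space coin_space
      unfolding coin_space_def
      by (intro prob_space.prob_space_stream_space measure_pmf.prob_space_axioms)
    show "OPT I / (2 - 1 / (real d)\<^sup>2) \<le>
        (\<integral>\<omega>. receiver_utility I (decode_scheme (output_mem (greedy_program d) I \<omega>)) \<partial>coin_space)"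
      unfolding eq lebesgue_integral_const
      using greedy_scheme_approximation[OF I(1) deg assms] by (simp only: prob_space scaleR_one)
  qed
qed

end
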